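(* Let $\mathbb{T}$ be a structure over a vocabulary $\mathcal{V}$ satisfying: (1) $\mathbb{T}$ is homogeneous; (2) $\mathbb{T}^d/{\simeq}$ is finite for every $d\in\mathbb{N}_+$, and there is an algorithm that, given $d$, outputs a list of quantifier-free formulas defining the equivalence classes of $\simeq$ on $\mathbb{T}^d$; (3) satisfiability in $\mathbb{T}$ of any quantifier-free $\mathcal{V}[\mathbb{T}]$-formula is decidable. Then, for every finite relational vocabulary $\mathcal{Q}$ disjoint from $\mathcal{V}[\mathbb{T}]$, the covering pre-order $\preceq$ on configurations satisfies, for every $\mathbb{T}$-predicate automaton $(\mathcal{Q},\Sigma\times\mathbb{T},\delta,\varphi_{\mathsf{start}},F)$: (i) $\preceq$ is decidable; (ii) given any configuration $\mathcal{C}$, one can effectively compute a finite set $\mathscr{C}$ of successors of $\mathcal{C}$ such that for every successor $\mathcal{C}'$ of $\mathcal{C}$ there is $\bar{\mathcal{C}}'\in\mathscr{C}$ with $\bar{\mathcal{C}}'\preceq\mathcal{C}'$; (iii) for all configurations $\bar{\mathcal{C}}\preceq\mathcal{C}$, if $\mathcal{C}$ is accepting then $\bar{\mathcal{C}}$ is accepting, and for every $\mathcal{C}'$ with $\mathcal{C}\to\mathcal{C}'$ there is $\bar{\mathcal{C}}'$ with $\bar{\mathcal{C}}\to\bar{\mathcal{C}}'$.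
   Context: Standing computability assumptions: elements of $\mathbb{T}$ and symbols of $\mathcal{V}$ are finitely representable, and interpretations of the symbols are computable. For a set $V$ of elements, $N(V)$ is the substructure generated by $V$; $N(\vec a)$ that of the entries of $\vec a$. For $\vec a,\vec b\in\mathbb{T}^d$, $\vec a\simeq\vec b$ if there is an isomorphism $\beta:N(\vec a)\to N(\vec b)$ with $\beta(\vec a)=\vec b$. $\mathbb{T}$ is homogeneous if every isomorphism between two finitely generated substructures of $\mathbb{T}$ extends to an automorphism of $\mathbb{T}$. $\mathcal{V}[\mathbb{T}]$ expands $\mathcal{V}$ by a constant per element of $\mathbb{T}$. A $\mathbb{T}$-predicate automaton is $A=(\mathcal{Q},\Sigma\times\mathbb{T},\delta,\varphi_{\mathsf{start}},F)$ with $\Sigma$ finite; $\mathcal{F}_+(\mathcal{V},\mathcal{Q})$ denotes quantifier-free $(\mathcal{V}\cup\mathcal{Q})$-formulas with all $\mathcal{Q}$-atoms positive; $\varphi_{\mathsf{start}}\in\mathcal{F}_+(\mathcal{V},\mathcal{Q})$ has no free variables; $F\subseteq\mathcal{Q}$; $\delta:\mathcal{Q}\times\Sigma\to\mathcal{F}_+(\mathcal{V},\mathcal{Q})$ with the free variables of $\delta(q,\sigma)$ among $v_0,\dots,v_{\mathsf{ar}(q)}$. States are ground atoms $q(a_1,\dots,a_{\mathsf{ar}(q)})$, $a_j\in\mathbb{T}$; $\hat\delta(q(a_1,\dots),\langle\sigma:a_0\rangle)$ is $\delta(q,\sigma)$ with $v_j\mapsto a_j$ and $\mathcal{V}$-atoms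 evaluated in $\mathbb{T}$. A configuration is a finite set of states (a conjunction); accepting if all its predicate symbols lie in $F$. $\mathcal{C}\xrightarrow{\sigma:a}\mathcal{C}'$ iff $\mathcal{C}'$ is a cube of the DNF of $\bigwedge_{t\in\mathcal{C}}\hat\delta(t,\langle\sigma:a\rangle)$; $\mathcal{C}\to\mathcal{C}'$ ($\mathcal{C}'$ a successor) if this holds for some letter. Covering pre-order: $\mathcal{C}\preceq\mathcal{C}'$ iff there is an automorphism $\pi$ of $\mathbb{T}$ such that $q(\pi(a_1),\dots,\pi(a_{\mathsf{ar}(q)}))\in\mathcal{C}'$ for every $q(a_1,\dots,a_{\mathsf{ar}(q)})\in\mathcal{C}$. *)

theory Defs
  imports Main "HOL-Library.Nat_Bijection"
begin

section \<open>Computability\<close>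

text \<open>Partial recursive functions on the natural numbers, presented as unary functions with a pairing
  function: the least class containing zero, successor and the two projections and closed under
  pairing, composition, primitive recursion and unbounded minimisation.\<close>

definition minimise :: "(nat \<Rightarrow> nat option) \<Rightarrow> nat option" where
  "minimise h =
     (if \<exists>n. h n = Some 0 \<and> (\<forall>m<n. \<exists>y. h m = Some (Suc y))
      then Some (LEAST n. h n = Some 0) else None)"

inductive partrec :: "(nat \<Rightarrow> nat option) \<Rightarrow> bool" where
  zero: "partrec (\<lambda>_. Some 0)"
| succ: "partrec (\<lambda>n. Some (Suc n))"
| left: "partrec (\<lambda>n. Some (fst (prod_decode n)))"
| right: "partrec (\<lambda>n. Some (snd (prod_decode n)))"
| pair: "partrec f \<Longrightarrow> partrec g \<Longrightarrow>
    partrec (\<lambda>n. Option.bind (f n) (\<lambda>x. Option.bind (g n) (\<lambda>y. Some (prod_encode (x, y)))))"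
| comp: "partrec f \<Longrightarrow> partrec g \<Longrightarrow> partrec (\<lambda>n. Option.bind (g n) f)"
| prec: "partrec f \<Longrightarrow> partrec g \<Longrightarrow>
    partrec (\<lambda>n. case prod_decode n of (a, k) \<Rightarrow>
      rec_nat (f a) (\<lambda>y r. Option.bind r (\<lambda>i. g (prod_encode (a, prod_encode (y, i))))) k)"
| mu: "partrec f \<Longrightarrow> partrec (\<lambda>a. minimise (\<lambda>n. f (prod_encode (a, n))))"

text \<open>Algorithms are only required to behave correctly on codes of admissible inputs, that is, on
  elements of \<open>D\<close>.\<close>

definition computable_on :: "'i set \<Rightarrow> ('i \<Rightarrow> nat) \<Rightarrow> ('o \<Rightarrow> nat) \<Rightarrow> ('i \<Rightarrow> 'o) \<Rightarrow> bool" where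
  "computable_on D cin cout f \<longleftrightarrow>
     (\<exists>p. partrec p \<and> (\<forall>x\<in>D. p (cin x) = Some (cout (f x))))"

definition decidable_on :: "'i set \<Rightarrow> ('i \<Rightarrow> nat) \<Rightarrow> ('i \<Rightarrow> bool) \<Rightarrow> bool" where
  "decidable_on D cin P \<longleftrightarrow> computable_on D cin of_bool P"

section \<open>Structures and quantifier-free formulas\<close>

text \<open>Constants are function symbols of arity 0.\<close>

record ('f, 'r) vocab =
  funs :: "'f set"
  rels :: "'r set"
  far :: "'f \<Rightarrow> nat"
  rar :: "'r \<Rightarrow> nat"

record ('f, 'r, 'a) struct =
  univ :: "'a set"
  fint :: "'f \<Rightarrow> 'a list \<Rightarrow> 'a"
  rint :: "'r \<Rightarrow> 'a list \<Rightarrow> bool"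

definition tuples :: "('f, 'r, 'a) struct \<Rightarrow> nat \<Rightarrow> 'a list set" where
  "tuples T d = {xs. length xs = d \<and> set xs \<subseteq> univ T}"

definition is_struct :: "('f, 'r) vocab \<Rightarrow> ('f, 'r, 'a) struct \<Rightarrow> bool" where
  "is_struct V T \<longleftrightarrow> univ T \<noteq> {} \<and>
     (\<forall>f\<in>funs V. \<forall>xs\<in>tuples T (far V f). fint T f xs \<in> univ T)"

datatype 'f tm = Var nat | Fun 'f "'f tm list"

primrec tm_vars :: "'f tm \<Rightarrow> nat set" where
  "tm_vars (Var i) = {i}"
| "tm_vars (Fun f ts) = \<Union> (set (map tm_vars ts))"

primrec wf_tm :: "('f, 'r) vocab \<Rightarrow> 'f tm \<Rightarrow> bool" where
  "wf_tm V (Var i) \<longleftrightarrow> True"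
| "wf_tm V (Fun f ts) \<longleftrightarrow> f \<in> funs V \<and> length ts = far V f \<and> list_all id (map (wf_tm V) ts)"

primrec eval_tm :: "('f, 'r, 'a) struct \<Rightarrow> (nat \<Rightarrow> 'a) \<Rightarrow> 'f tm \<Rightarrow> 'a" where
  "eval_tm T \<nu> (Var i) = \<nu> i"
| "eval_tm T \<nu> (Fun f ts) = fint T f (map (eval_tm T \<nu>) ts)"

text \<open>Boolean combinations of atoms of an arbitrary type. They serve both for quantifier-free
  first-order formulas and for propositional combinations of ground atoms.\<close>

datatype 'p form = Tru | Fls | Atom 'p | Neg "'p form" | Conj "'p form" "'p form" | Disj "'p form" "'p form"

datatype ('f, 'r) atom = Eq "'f tm" "'f tm" | Rel 'r "'f tm list"

type_synonym ('f, 'r) qf = "('f, 'r) atom form"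

primrec atom_vars :: "('f, 'r) atom \<Rightarrow> nat set" where
  "atom_vars (Eq s t) = tm_vars s \<union> tm_vars t"
| "atom_vars (Rel r ts) = (\<Union>t\<in>set ts. tm_vars t)"

definition free_vars :: "('f, 'r) qf \<Rightarrow> nat set" where
  "free_vars \<phi> = (\<Union>p\<in>set_form \<phi>. atom_vars p)"

primrec wf_atom :: "('f, 'r) vocab \<Rightarrow> ('f, 'r) atom \<Rightarrow> bool" where
  "wf_atom V (Eq s t) \<longleftrightarrow> wf_tm V s \<and> wf_tm V t"
| "wf_atom V (Rel r ts) \<longleftrightarrow> r \<in> rels V \<and> length ts = rar V r \<and> (\<forall>t\<in>set ts. wf_tm V t)"

definition qf_formulas :: "('f, 'r) vocab \<Rightarrow> ('f, 'r) qf set" where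
  "qf_formulas V = {\<phi>. \<forall>p\<in>set_form \<phi>. wf_atom V p}"

primrec atom_holds :: "('f, 'r, 'a) struct \<Rightarrow> (nat \<Rightarrow> 'a) \<Rightarrow> ('f, 'r) atom \<Rightarrow> bool" where
  "atom_holds T \<nu> (Eq s t) \<longleftrightarrow> eval_tm T \<nu> s = eval_tm T \<nu> t"
| "atom_holds T \<nu> (Rel r ts) \<longleftrightarrow> rint T r (map (eval_tm T \<nu>) ts)"

primrec holds :: "('f, 'r, 'a) struct \<Rightarrow> (nat \<Rightarrow> 'a) \<Rightarrow> ('f, 'r) qf \<Rightarrow> bool" where
  "holds T \<nu> Tru \<longleftrightarrow> True"
| "holds T \<nu> Fls \<longleftrightarrow> False"
| "holds T \<nu> (Atom p) \<longleftrightarrow> atom_holds T \<nu> p"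
| "holds T \<nu> (Neg \<phi>) \<longleftrightarrow> \<not> holds T \<nu> \<phi>"
| "holds T \<nu> (Conj \<phi> \<psi>) \<longleftrightarrow> holds T \<nu> \<phi> \<and> holds T \<nu> \<psi>"
| "holds T \<nu> (Disj \<phi> \<psi>) \<longleftrightarrow> holds T \<nu> \<phi> \<or> holds T \<nu> \<psi>"

definition satisfiable :: "('f, 'r, 'a) struct \<Rightarrow> ('f, 'r) qf \<Rightarrow> bool" where
  "satisfiable T \<phi> \<longleftrightarrow> (\<exists>\<nu>. range \<nu> \<subseteq> univ T \<and> holds T \<nu> \<phi>)"

text \<open>The expansion by a constant \<open>Inr a\<close> for every element \<open>a\<close>.\<close>

definition const_vocab :: "('f, 'r) vocab \<Rightarrow> ('f, 'r, 'a) struct \<Rightarrow> ('f + 'a, 'r) vocab" where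
  "const_vocab V T = \<lparr>funs = funs V <+> univ T, rels = rels V,
     far = case_sum (far V) (\<lambda>_. 0), rar = rar V\<rparr>"

definition const_struct :: "('f, 'r, 'a) struct \<Rightarrow> ('f + 'a, 'r, 'a) struct" where
  "const_struct T = \<lparr>univ = univ T, fint = case_sum (fint T) (\<lambda>a _. a), rint = rint T\<rparr>"

section \<open>Generated substructures, isomorphisms, homogeneity\<close>

text \<open>Substructures are identified with their universes.\<close>

inductive_set gen :: "('f, 'r) vocab \<Rightarrow> ('f, 'r, 'a) struct \<Rightarrow> 'a set \<Rightarrow> 'a set"
  for V :: "('f, 'r) vocab" and T :: "('f, 'r, 'a) struct" and S :: "'a set" where
  base: "x \<in> S \<Longrightarrow> x \<in> gen V T S"
| app: "f \<in> funs V \<Longrightarrow> length xs = far V f \<Longrightarrow> \<forall>x\<in>set xs. x \<in> gen V T S \<Longrightarrow> fint T f xs \<in> gen V T S"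

definition iso_betw :: "('f, 'r) vocab \<Rightarrow> ('f, 'r, 'a) struct \<Rightarrow> ('a \<Rightarrow> 'a) \<Rightarrow> 'a set \<Rightarrow> 'a set \<Rightarrow> bool" where
  "iso_betw V T \<beta> A B \<longleftrightarrow> bij_betw \<beta> A B \<and>
     (\<forall>f\<in>funs V. \<forall>xs. length xs = far V f \<and> set xs \<subseteq> A \<longrightarrow>
        \<beta> (fint T f xs) = fint T f (map \<beta> xs)) \<and>
     (\<forall>r\<in>rels V. \<forall>xs. length xs = rar V r \<and> set xs \<subseteq> A \<longrightarrow>
        (rint T r xs \<longleftrightarrow> rint T r (map \<beta> xs)))"

definition automorphism :: "('f, 'r) vocab \<Rightarrow> ('f, 'r, 'a) struct \<Rightarrow> ('a \<Rightarrow> 'a) \<Rightarrow> bool" where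
  "automorphism V T \<pi> \<longleftrightarrow> iso_betw V T \<pi> (univ T) (univ T)"

definition homogeneous :: "('f, 'r) vocab \<Rightarrow> ('f, 'r, 'a) struct \<Rightarrow> bool" where
  "homogeneous V T \<longleftrightarrow>
     (\<forall>X Y \<beta>. finite X \<and> X \<subseteq> univ T \<and> finite Y \<and> Y \<subseteq> univ T \<and>
        iso_betw V T \<beta> (gen V T X) (gen V T Y) \<longrightarrow>
        (\<exists>\<pi>. automorphism V T \<pi> \<and> (\<forall>x\<in>gen V T X. \<pi> x = \<beta> x)))"

definition simeq :: "('f, 'r) vocab \<Rightarrow> ('f, 'r, 'a) struct \<Rightarrow> nat \<Rightarrow> ('a list \<times> 'a list) set" where
  "simeq V T d = {(xs, ys). xs \<in> tuples T d \<and> ys \<in> tuples T d \<and>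
     (\<exists>\<beta>. iso_betw V T \<beta> (gen V T (set xs)) (gen V T (set ys)) \<and> map \<beta> xs = ys)}"

text \<open>The sets defined by the formulas in the list are exactly the classes of \<open>d\<close>-tuples; the
  \<open>i\<close>-th entry of a tuple (counted from 0) is the value of the variable \<open>i\<close>.\<close>

definition defines_classes ::
    "('f, 'r) vocab \<Rightarrow> ('f, 'r, 'a) struct \<Rightarrow> nat \<Rightarrow> ('f, 'r) qf list \<Rightarrow> bool" where
  "defines_classes V T d \<phi>s \<longleftrightarrow>
     (\<forall>\<phi>\<in>set \<phi>s. \<phi> \<in> qf_formulas V \<and> free_vars \<phi> \<subseteq> {..<d}) \<and>
     (\<lambda>\<phi>. {xs \<in> tuples T d. holds T (\<lambda>i. xs ! i) \<phi>}) ` set \<phi>s = tuples T d // simeq V T d"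

section \<open>Codes\<close>

primrec tm_code :: "('f \<Rightarrow> nat) \<Rightarrow> 'f tm \<Rightarrow> nat" where
  "tm_code cf (Var i) = prod_encode (0, i)"
| "tm_code cf (Fun f ts) = prod_encode (1, prod_encode (cf f, list_encode (map (tm_code cf) ts)))"

primrec atom_code :: "('f \<Rightarrow> nat) \<Rightarrow> ('r \<Rightarrow> nat) \<Rightarrow> ('f, 'r) atom \<Rightarrow> nat" where
  "atom_code cf cr (Eq s t) = prod_encode (0, prod_encode (tm_code cf s, tm_code cf t))"
| "atom_code cf cr (Rel r ts) =
     prod_encode (1, prod_encode (cr r, list_encode (map (tm_code cf) ts)))"

primrec form_code :: "('p \<Rightarrow> nat) \<Rightarrow> 'p form \<Rightarrow> nat" where
  "form_code cp Tru = prod_encode (0, 0)"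
| "form_code cp Fls = prod_encode (1, 0)"
| "form_code cp (Atom p) = prod_encode (2, cp p)"
| "form_code cp (Neg \<phi>) = prod_encode (3, form_code cp \<phi>)"
| "form_code cp (Conj \<phi> \<psi>) = prod_encode (4, prod_encode (form_code cp \<phi>, form_code cp \<psi>))"
| "form_code cp (Disj \<phi> \<psi>) = prod_encode (5, prod_encode (form_code cp \<phi>, form_code cp \<psi>))"

definition qf_code :: "('f \<Rightarrow> nat) \<Rightarrow> ('r \<Rightarrow> nat) \<Rightarrow> ('f, 'r) qf \<Rightarrow> nat" where
  "qf_code cf cr = form_code (atom_code cf cr)"

definition const_code :: "('f \<Rightarrow> nat) \<Rightarrow> ('a \<Rightarrow> nat) \<Rightarrow> 'f + 'a \<Rightarrow> nat" where
  "const_code cf ca s = sum_encode (map_sum cf ca s)"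

definition app_code :: "('s \<Rightarrow> nat) \<Rightarrow> ('a \<Rightarrow> nat) \<Rightarrow> 's \<times> 'a list \<Rightarrow> nat" where
  "app_code cs ca = (\<lambda>(s, xs). prod_encode (cs s, list_encode (map ca xs)))"

text \<open>Finite representability: symbols and elements have unique codes, and the codes of elements
  can be listed by an algorithm (the range of a total recursive function). Interpretations are
  computable uniformly in the symbol, which matters only for infinite vocabularies.\<close>

definition effective_presentation ::
    "('f, 'r) vocab \<Rightarrow> ('f, 'r, 'a) struct \<Rightarrow> ('f \<Rightarrow> nat) \<Rightarrow> ('r \<Rightarrow> nat) \<Rightarrow> ('a \<Rightarrow> nat) \<Rightarrow> bool" where
  "effective_presentation V T cf cr ca \<longleftrightarrow>
     inj_on cf (funs V) \<and> inj_on cr (rels V) \<and> inj_on ca (univ T) \<and>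
     (\<exists>e. partrec (\<lambda>n. Some (e n)) \<and> range e = ca ` univ T) \<and>
     computable_on (SIGMA f:funs V. tuples T (far V f)) (app_code cf ca) ca
       (\<lambda>(f, xs). fint T f xs) \<and>
     decidable_on (SIGMA r:rels V. tuples T (rar V r)) (app_code cr ca)
       (\<lambda>(r, xs). rint T r xs)"

section \<open>Predicate automata\<close>

text \<open>The relational vocabulary \<open>Q\<close> is joined to \<open>V\<close> by a disjoint sum.\<close>

definition join_vocab :: "('f, 'r) vocab \<Rightarrow> ('f, 'q) vocab \<Rightarrow> ('f, 'r + 'q) vocab" where
  "join_vocab V Q = \<lparr>funs = funs V, rels = rels V <+> rels Q,
     far = far V, rar = case_sum (rar V) (rar Q)\<rparr>"

text \<open>Atoms with an occurrence under an even (\<open>b = True\<close>) or odd (\<open>b = False\<close>) number of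
  negations.\<close>

primrec occs :: "bool \<Rightarrow> 'p form \<Rightarrow> 'p set" where
  "occs b Tru = {}"
| "occs b Fls = {}"
| "occs b (Atom p) = (if b then {p} else {})"
| "occs b (Neg \<phi>) = occs (\<not> b) \<phi>"
| "occs b (Conj \<phi> \<psi>) = occs b \<phi> \<union> occs b \<psi>"
| "occs b (Disj \<phi> \<psi>) = occs b \<phi> \<union> occs b \<psi>"

definition pos_formulas :: "('f, 'r) vocab \<Rightarrow> ('f, 'q) vocab \<Rightarrow> ('f, 'r + 'q) qf set" where
  "pos_formulas V Q =
     {\<phi> \<in> qf_formulas (join_vocab V Q). \<forall>q ts. Rel (Inr q) ts \<notin> occs False \<phi>}"

record ('f, 'r, 'q, 's) pautomaton =
  alphabet :: "'s set"
  delta :: "'q \<Rightarrow> 's \<Rightarrow> ('f, 'r + 'q) qf"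
  start :: "('f, 'r + 'q) qf"
  final :: "'q set"

definition predicate_automaton ::
    "('f, 'r) vocab \<Rightarrow> ('f, 'q) vocab \<Rightarrow> ('f, 'r, 'q, 's) pautomaton \<Rightarrow> bool" where
  "predicate_automaton V Q A \<longleftrightarrow>
     finite (alphabet A) \<and>
     (\<forall>q\<in>rels Q. \<forall>\<sigma>\<in>alphabet A.
        delta A q \<sigma> \<in> pos_formulas V Q \<and> free_vars (delta A q \<sigma>) \<subseteq> {..rar Q q}) \<and>
     start A \<in> pos_formulas V Q \<and> free_vars (start A) = {} \<and>
     final A \<subseteq> rels Q"

type_synonym ('q, 'a) state = "'q \<times> 'a list"

definition states :: "('f, 'r, 'a) struct \<Rightarrow> ('f, 'q) vocab \<Rightarrow> ('q, 'a) state set" where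
  "states T Q = (SIGMA q:rels Q. tuples T (rar Q q))"

definition configs :: "('f, 'r, 'a) struct \<Rightarrow> ('f, 'q) vocab \<Rightarrow> ('q, 'a) state set set" where
  "configs T Q = {C. finite C \<and> C \<subseteq> states T Q}"

definition accepting :: "('f, 'r, 'q, 's) pautomaton \<Rightarrow> ('q, 'a) state set \<Rightarrow> bool" where
  "accepting A C \<longleftrightarrow> fst ` C \<subseteq> final A"

fun inst_atom :: "('f, 'r, 'a) struct \<Rightarrow> (nat \<Rightarrow> 'a) \<Rightarrow> ('f, 'r + 'q) atom \<Rightarrow> ('q, 'a) state form" where
  "inst_atom T \<nu> (Eq s t) = (if eval_tm T \<nu> s = eval_tm T \<nu> t then Tru else Fls)"
| "inst_atom T \<nu> (Rel (Inl r) ts) = (if rint T r (map (eval_tm T \<nu>) ts) then Tru else Fls)"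
| "inst_atom T \<nu> (Rel (Inr q) ts) = Atom (q, map (eval_tm T \<nu>) ts)"

primrec inst :: "('f, 'r, 'a) struct \<Rightarrow> (nat \<Rightarrow> 'a) \<Rightarrow> ('f, 'r + 'q) qf \<Rightarrow> ('q, 'a) state form" where
  "inst T \<nu> Tru = Tru"
| "inst T \<nu> Fls = Fls"
| "inst T \<nu> (Atom p) = inst_atom T \<nu> p"
| "inst T \<nu> (Neg \<phi>) = Neg (inst T \<nu> \<phi>)"
| "inst T \<nu> (Conj \<phi> \<psi>) = Conj (inst T \<nu> \<phi>) (inst T \<nu> \<psi>)"
| "inst T \<nu> (Disj \<phi> \<psi>) = Disj (inst T \<nu> \<phi>) (inst T \<nu> \<psi>)"

text \<open>The variable 0 is the letter read, the variables 1, 2, ... are the arguments of the state.\<close>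

definition delta_hat :: "('f, 'r, 'a) struct \<Rightarrow> ('f, 'r, 'q, 's) pautomaton \<Rightarrow>
    ('q, 'a) state \<Rightarrow> 's \<Rightarrow> 'a \<Rightarrow> ('q, 'a) state form" where
  "delta_hat T A t \<sigma> a = (case t of (q, as) \<Rightarrow> inst T (\<lambda>j. (a # as) ! j) (delta A q \<sigma>))"

text \<open>The cubes, as sets of literals, of the disjunctive normal form of \<open>\<phi>\<close> (\<open>b = True\<close>) or of its
  negation (\<open>b = False\<close>), obtained by pushing negations inwards and distributing.\<close>

primrec dnf :: "bool \<Rightarrow> 'p form \<Rightarrow> ('p \<times> bool) set set" where
  "dnf b Tru = (if b then {{}} else {})"
| "dnf b Fls = (if b then {} else {{}})"
| "dnf b (Atom p) = {{(p, b)}}"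
| "dnf b (Neg \<phi>) = dnf (\<not> b) \<phi>"
| "dnf b (Conj \<phi> \<psi>) =
     (if b then {c \<union> d |c d. c \<in> dnf b \<phi> \<and> d \<in> dnf b \<psi>} else dnf b \<phi> \<union> dnf b \<psi>)"
| "dnf b (Disj \<phi> \<psi>) =
     (if b then dnf b \<phi> \<union> dnf b \<psi> else {c \<union> d |c d. c \<in> dnf b \<phi> \<and> d \<in> dnf b \<psi>})"

text \<open>The list \<open>ts\<close> only fixes an order of the conjuncts, on which the set of cubes does not depend.\<close>

definition step :: "('f, 'r, 'a) struct \<Rightarrow> ('f, 'r, 'q, 's) pautomaton \<Rightarrow>
    ('q, 'a) state set \<Rightarrow> 's \<Rightarrow> 'a \<Rightarrow> ('q, 'a) state set \<Rightarrow> bool" where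
  "step T A C \<sigma> a C' \<longleftrightarrow>
     (\<exists>ts. distinct ts \<and> set ts = C \<and>
        (\<lambda>t. (t, True)) ` C' \<in> dnf True (foldr Conj (map (\<lambda>t. delta_hat T A t \<sigma> a) ts) Tru))"

definition successor :: "('f, 'r, 'a) struct \<Rightarrow> ('f, 'r, 'q, 's) pautomaton \<Rightarrow>
    ('q, 'a) state set \<Rightarrow> ('q, 'a) state set \<Rightarrow> bool" where
  "successor T A C C' \<longleftrightarrow> (\<exists>\<sigma>\<in>alphabet A. \<exists>a\<in>univ T. step T A C \<sigma> a C')"

definition covering_le :: "('f, 'r) vocab \<Rightarrow> ('f, 'r, 'a) struct \<Rightarrow>
    ('q, 'a) state set \<Rightarrow> ('q, 'a) state set \<Rightarrow> bool" where
  "covering_le V T C C' \<longleftrightarrow>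
     (\<exists>\<pi>. automorphism V T \<pi> \<and> (\<forall>(q, as)\<in>C. (q, map \<pi> as) \<in> C'))"

definition config_code :: "('q \<Rightarrow> nat) \<Rightarrow> ('a \<Rightarrow> nat) \<Rightarrow> ('q, 'a) state set \<Rightarrow> nat" where
  "config_code cq ca C = set_encode (app_code cq ca ` C)"

end

theory Submission
  imports Defs
begin

text \<open>By homogeneity, two tuples have the same type iff an automorphism moves one to the other, so the
  formulas listed for each length decide whether such an automorphism exists. An automorphism
  witnessing covering matters only through the images of the finitely many states of the smaller
  configuration, and these can be searched exhaustively. For the successors of a configuration with
  arguments \<open>a\<close>, it suffices to read one letter \<open>x\<close> for every type of a tuple \<open>(a, x)\<close>: another
  letter of the same type is the image of \<open>x\<close> under an automorphism fixing \<open>a\<close>, and transitions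
  commute with automorphisms. A formula is evaluated at a tuple by asking whether its conjunction
  with equations pinning the variables to constants is satisfiable; this leaves only one traversal of
  formula codes, the one renaming the function symbols to those of the vocabulary with constants.\<close>

section \<open>Closure properties of computable functions\<close>

text \<open>Computability is relative to coded domains: a program has to be right only on codes from
  the domain, and the satisfiability oracle promises nothing on numbers that code no well-formed
  formula. Domains are therefore carried through every conditional and every recursion, and the step
  of a loop has to be computable only at values that the loop reaches. The automaton is fixed before
  any input arrives, so recursion over its formulas builds a program and is not executed by one. The
  formulas listed for the types, by contrast, depend on the length of the argument list and exist
  only as codes; evaluating them directly would take an interpreter for codes of formulas, which the
  oracle replaces. The oracle only says that a suitable letter exists, so the letter itself is found
  by running through the enumeration of the universe that the presentation provides.\<close>

definition pair_code :: "('i \<Rightarrow> nat) \<Rightarrow> ('j \<Rightarrow> nat) \<Rightarrow> 'i \<times> 'j \<Rightarrow> nat" where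
  "pair_code c d = (\<lambda>(x, y). prod_encode (c x, d y))"

text \<open>A combinator on codings, so that it nests (lists of lists of states) and the closure
  rules can recognise a coding by its shape.\<close>

definition list_code :: "('i \<Rightarrow> nat) \<Rightarrow> 'i list \<Rightarrow> nat" where
  "list_code c xs = list_encode (map c xs)"

lemma pair_code_Pair [simp]: "pair_code c d (x, y) = prod_encode (c x, d y)"
  by (simp add: pair_code_def)

lemma list_code_Nil [simp]: "list_code c [] = 0"
  by (simp add: list_code_def)

lemma list_code_Cons [simp]: "list_code c (x # xs) = Suc (prod_encode (c x, list_code c xs))"
  by (simp add: list_code_def)

lemma list_code_id [simp]: "list_code id = list_encode"
  by (simp add: list_code_def fun_eq_iff)

lemma app_code_eq_pair_code: "app_code cs ca = pair_code cs (list_code ca)"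
  by (simp add: app_code_def pair_code_def list_code_def fun_eq_iff)

lemma computable_onI:
  "partrec p \<Longrightarrow> (\<And>x. x \<in> D \<Longrightarrow> p (c x) = Some (d (f x))) \<Longrightarrow> computable_on D c d f"
  by (auto simp: computable_on_def)

lemma computable_onE:
  assumes "computable_on D c d f"
  obtains p where "partrec p" "\<And>x. x \<in> D \<Longrightarrow> p (c x) = Some (d (f x))"
  using assms by (auto simp: computable_on_def)

text \<open>A program sees its outputs only through their codes, so it also computes any function
  whose outputs have the same codes. Truth values thus turn into 0 and 1, and sets of states into
  sets of numbers, with no change of program.\<close>

lemma computable_on_recode:
  "computable_on D c d f \<Longrightarrow> (\<And>x. x \<in> D \<Longrightarrow> d' (f' x) = d (f x)) \<Longrightarrow> computable_on D c d' f'"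
  by (auto simp: computable_on_def)

lemma computable_on_cong:
  "computable_on D c d f \<Longrightarrow> (\<And>x. x \<in> D \<Longrightarrow> f' x = f x) \<Longrightarrow> computable_on D c d f'"
  by (erule computable_on_recode) simp

lemma computable_on_subset: "computable_on E c d f \<Longrightarrow> D \<subseteq> E \<Longrightarrow> computable_on D c d f"
  by (auto simp: computable_on_def)

lemma computable_on_comp:
  assumes "computable_on E d e g" "computable_on D c d f" "\<And>x. x \<in> D \<Longrightarrow> f x \<in> E"
  shows "computable_on D c e (\<lambda>x. g (f x))"
proof -
  obtain p where p: "partrec p" "\<And>x. x \<in> D \<Longrightarrow> p (c x) = Some (d (f x))"
    using assms(2) by (rule computable_onE) blast
  obtain q where q: "partrec q" "\<And>x. x \<in> E \<Longrightarrow> q (d x) = Some (e (g x))"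
    using assms(1) by (rule computable_onE) blast
  show ?thesis
    by (rule computable_onI[OF partrec.comp[OF q(1) p(1)]]) (simp add: p(2) q(2) assms(3))
qed

lemma computable_on_comp_total:
  "computable_on UNIV d e g \<Longrightarrow> computable_on D c d f \<Longrightarrow> computable_on D c e (\<lambda>x. g (f x))"
  by (rule computable_on_comp) auto

lemma partrec_const: "partrec (\<lambda>_. Some k)"
proof (induction k)
  case 0 show ?case by (rule partrec.zero)
next
  case (Suc k) show ?case using partrec.comp[OF partrec.succ Suc] by simp
qed

lemma computable_on_const [intro]: "computable_on D c d (\<lambda>_. k)"
  by (rule computable_onI[OF partrec_const]) simp

lemma computable_on_pair:
  assumes "computable_on D c d f" "computable_on D c e g"
  shows "computable_on D c (pair_code d e) (\<lambda>x. (f x, g x))"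
proof -
  obtain p where p: "partrec p" "\<And>x. x \<in> D \<Longrightarrow> p (c x) = Some (d (f x))"
    using assms(1) by (rule computable_onE) blast
  obtain q where q: "partrec q" "\<And>x. x \<in> D \<Longrightarrow> q (c x) = Some (e (g x))"
    using assms(2) by (rule computable_onE) blast
  show ?thesis
    by (rule computable_onI[OF partrec.pair[OF p(1) q(1)]]) (simp add: p(2) q(2))
qed

lemma computable_on_fst_arg: "computable_on D (pair_code c d) c fst"
  by (rule computable_onI[OF partrec.left]) (auto simp: pair_code_def)

lemma computable_on_snd_arg: "computable_on D (pair_code c d) d snd"
  by (rule computable_onI[OF partrec.right]) (auto simp: pair_code_def)

lemma computable_on_fst: "computable_on D c (pair_code d e) f \<Longrightarrow> computable_on D c d (\<lambda>x. fst (f x))"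
  by (rule computable_on_comp_total[OF computable_on_fst_arg])

lemma computable_on_snd: "computable_on D c (pair_code d e) f \<Longrightarrow> computable_on D c e (\<lambda>x. snd (f x))"
  by (rule computable_on_comp_total[OF computable_on_snd_arg])

lemma computable_on_id: "computable_on D c c (\<lambda>x. x)"
proof (rule computable_onI)
  show "partrec (\<lambda>n. Option.bind (Some (prod_encode (n, 0))) (\<lambda>m. Some (fst (prod_decode m))))"
  proof (rule partrec.comp[OF partrec.left])
    \<comment> \<open>The generators contain no identity function; pairing the two projections of
      \<open>n\<close> gives back \<open>n\<close>.\<close>
    have "partrec (\<lambda>n. Some (prod_encode (fst (prod_decode n), snd (prod_decode n))))"
      using partrec.pair[OF partrec.left partrec.right] by simp
    then have "partrec (\<lambda>n. Some n)"
      by simp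
    from partrec.pair[OF this partrec.zero] show "partrec (\<lambda>n. Some (prod_encode (n, 0)))"
      by simp
  qed
qed simp

lemma computable_on_Suc: "computable_on D c id f \<Longrightarrow> computable_on D c id (\<lambda>x. Suc (f x))"
  by (rule computable_on_comp_total[where g=Suc])
    (auto intro: computable_onI[OF partrec.succ])

text \<open>The step has to be computable only where the recursion takes it: below the bound
  \<open>k x\<close>, with \<open>r\<close> the value accumulated so far. This admits partial
  operations such as \<open>!\<close> inside loops.\<close>

lemma computable_on_rec_nat:
  assumes b: "computable_on D c d b" and k: "computable_on D c id k"
    and s: "computable_on {(x, y, r). x \<in> D \<and> y < k x \<and> r = rec_nat (b x) (g x) y}
      (pair_code c (pair_code id d)) d (\<lambda>(x, y, r). g x y r)"
  shows "computable_on D c d (\<lambda>x. rec_nat (b x) (g x) (k x))"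
proof -
  obtain p where p: "partrec p" "\<And>x. x \<in> D \<Longrightarrow> p (c x) = Some (d (b x))"
    using b by (rule computable_onE) blast
  obtain q where q: "partrec q" and q':
    "\<And>z. z \<in> {(x, y, r). x \<in> D \<and> y < k x \<and> r = rec_nat (b x) (g x) y} \<Longrightarrow>
      q (pair_code c (pair_code id d) z) = Some (d ((\<lambda>(x, y, r). g x y r) z))"
    using s by (rule computable_onE) blast
  define P where "P = (\<lambda>n. case prod_decode n of (a, k) \<Rightarrow>
      rec_nat (p a) (\<lambda>y r. Option.bind r (\<lambda>i. q (prod_encode (a, prod_encode (y, i))))) k)"
  have P: "partrec P"
    unfolding P_def by (rule partrec.prec[OF p(1) q])
  have *: "P (prod_encode (c x, y)) = Some (d (rec_nat (b x) (g x) y))"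
    if "x \<in> D" "y \<le> k x" for x y
    using that(2)
  proof (induction y)
    case 0 show ?case by (simp add: P_def p(2) that(1))
  next
    case (Suc y)
    then show ?case
      using q'[of "(x, y, rec_nat (b x) (g x) y)"] that(1) by (simp add: P_def)
  qed
  have "computable_on D c (pair_code c id) (\<lambda>x. (x, k x))"
    by (rule computable_on_pair computable_on_id k)+
  then obtain r where r: "partrec r" "\<And>x. x \<in> D \<Longrightarrow> r (c x) = Some (prod_encode (c x, k x))"
    by (rule computable_onE) simp
  show ?thesis
    by (rule computable_onI[OF partrec.comp[OF P r(1)]]) (simp add: r(2) *)
qed

lemma computable_on_rec_nat_total:
  assumes "computable_on D c d b" "computable_on D c id k"
    and "computable_on UNIV (pair_code c (pair_code id d)) d (\<lambda>(x, y, r). g x y r)"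
  shows "computable_on D c d (\<lambda>x. rec_nat (b x) (g x) (k x))"
  by (rule computable_on_rec_nat[OF assms(1,2) computable_on_subset[OF assms(3)]]) simp

lemma computable_on_of_bool_iff:
  "computable_on D c id (\<lambda>x. of_bool (P x)) \<longleftrightarrow> computable_on D c of_bool P"
  by (simp add: computable_on_def)

lemma computable_on_code: "computable_on D c d f \<Longrightarrow> computable_on D c id (\<lambda>x. d (f x))"
  by (erule computable_on_recode) simp

lemma computable_on_not:
  assumes "computable_on D c of_bool P"
  shows "computable_on D c of_bool (\<lambda>x. \<not> P x)"
proof -
  have "computable_on D c id (\<lambda>x. rec_nat 1 (\<lambda>_ _. 0) (of_bool (P x)))"
    by (rule computable_on_rec_nat_total)
      (use assms in \<open>auto simp: computable_on_of_bool_iff case_prod_unfold\<close>)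
  then show ?thesis
    by (rule computable_on_recode) simp
qed

text \<open>The recursion evaluates a branch only if its condition holds, so each branch needs to be
  computable only there.\<close>

lemma computable_on_if:
  assumes P: "computable_on D c of_bool P"
    and f: "computable_on {x \<in> D. P x} c d f" and g: "computable_on {x \<in> D. \<not> P x} c d g"
  shows "computable_on D c d (\<lambda>x. if P x then f x else g x)"
proof -
  have 1: "computable_on D c id (\<lambda>x. rec_nat 0 (\<lambda>_ _. d (f x)) (of_bool (P x)))"
  proof (rule computable_on_rec_nat)
    show "computable_on D c id (\<lambda>x. of_bool (P x))"
      using P by (simp add: computable_on_of_bool_iff)
    show "computable_on {(x, y, r). x \<in> D \<and> y < of_bool (P x) \<and>
          r = rec_nat 0 (\<lambda>_ _. d (f x)) y}
        (pair_code c (pair_code id id)) id (\<lambda>(x, y, r). d (f x))"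
      unfolding case_prod_unfold
      by (rule computable_on_code[OF computable_on_comp[OF f computable_on_fst_arg]])
        (auto simp: of_bool_def split: if_splits)
  qed auto
  \<comment> \<open>The first recursion yields the code of \<open>f x\<close>, or 0 if the condition
    fails. It is the base of a second one, which in the latter case overwrites it with the code of
    \<open>g x\<close>.\<close>
  have "computable_on D c id (\<lambda>x. rec_nat (rec_nat 0 (\<lambda>_ _. d (f x)) (of_bool (P x)))
      (\<lambda>_ _. d (g x)) (of_bool (\<not> P x)))"
  proof (rule computable_on_rec_nat[OF 1])
    show "computable_on D c id (\<lambda>x. of_bool (\<not> P x))"
      using computable_on_not[OF P] by (simp only: computable_on_of_bool_iff)
    show "computable_on {(x, y, r). x \<in> D \<and> y < of_bool (\<not> P x) \<and>
          r = rec_nat (rec_nat 0 (\<lambda>_ _. d (f x)) (of_bool (P x))) (\<lambda>_ _. d (g x)) y}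
        (pair_code c (pair_code id id)) id (\<lambda>(x, y, r). d (g x))"
      unfolding case_prod_unfold
      by (rule computable_on_code[OF computable_on_comp[OF g computable_on_fst_arg]])
        (auto simp: of_bool_def split: if_splits)
  qed
  then show ?thesis
    by (rule computable_on_recode) simp
qed

lemma computable_on_if_total:
  assumes "computable_on D c of_bool P" "computable_on D c d f" "computable_on D c d g"
  shows "computable_on D c d (\<lambda>x. if P x then f x else g x)"
  by (rule computable_on_if) (use assms in \<open>auto intro: computable_on_subset\<close>)

lemma computable_on_and:
  assumes "computable_on D c of_bool P" "computable_on D c of_bool Q"
  shows "computable_on D c of_bool (\<lambda>x. P x \<and> Q x)"
  by (rule computable_on_cong[OF computable_on_if_total[OF assms computable_on_const[where k=False]]])
    simp

lemma computable_on_Least: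
  assumes P: "computable_on (D \<times> UNIV) (pair_code c id) of_bool (\<lambda>(x, n). P x n)"
    and ex: "\<And>x. x \<in> D \<Longrightarrow> \<exists>n. P x n"
  shows "computable_on D c id (\<lambda>x. LEAST n. P x n)"
proof -
  \<comment> \<open>Minimisation stops at the first value 0 and demands a nonzero value before it;
    truth is coded by 1, hence the negation.\<close>
  have "computable_on (D \<times> UNIV) (pair_code c id) of_bool (\<lambda>z. \<not> (case z of (x, n) \<Rightarrow> P x n))"
    by (rule computable_on_not[OF P])
  then obtain p where p: "partrec p"
    and p': "\<And>z. z \<in> D \<times> UNIV \<Longrightarrow>
      p (pair_code c id z) = Some (of_bool (\<not> (case z of (x, n) \<Rightarrow> P x n)))"
    by (rule computable_onE) blast
  show ?thesis
  proof (rule computable_onI[OF partrec.mu[OF p]])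
    fix x assume x: "x \<in> D"
    have eq: "p (prod_encode (c x, n)) = Some (of_bool (\<not> P x n))" for n
      using p'[of "(x, n)"] x by simp
    have eq0: "p (prod_encode (c x, n)) = Some 0 \<longleftrightarrow> P x n" for n
      by (simp add: eq)
    have least: "P x (LEAST n. P x n)"
      using ex[OF x] by (rule LeastI_ex)
    have "\<exists>n. p (prod_encode (c x, n)) = Some 0 \<and>
        (\<forall>m<n. \<exists>y. p (prod_encode (c x, m)) = Some (Suc y))"
      by (rule exI[of _ "LEAST n. P x n"]) (use least in \<open>auto simp: eq dest: not_less_Least\<close>)
    then show "minimise (\<lambda>n. p (prod_encode (c x, n))) = Some (id (LEAST n. P x n))"
      unfolding minimise_def by (simp add: eq0)
  qed
qed

subsection \<open>Arithmetic\<close>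

text \<open>Replaces patterns by projections, the form in which the closure rules apply.\<close>

lemma computable_on_case_triple:
  assumes "computable_on D (pair_code c (pair_code d e)) h
    (\<lambda>z. f (fst z) (fst (snd z)) (snd (snd z)))"
  shows "computable_on D (pair_code c (pair_code d e)) h (\<lambda>(x, y, z). f x y z)"
  using assms by (simp add: case_prod_unfold)

lemma computable_on_fst_snd_arg: "computable_on D (pair_code c (pair_code d e)) d (\<lambda>z. fst (snd z))"
  by (rule computable_on_fst[OF computable_on_snd_arg])

lemma computable_on_snd_snd_arg: "computable_on D (pair_code c (pair_code d e)) e (\<lambda>z. snd (snd z))"
  by (rule computable_on_snd[OF computable_on_snd_arg])

lemmas computable_on_proj = computable_on_fst_arg computable_on_snd_arg
  computable_on_fst_snd_arg computable_on_snd_snd_arg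

lemma computable_on_add:
  assumes "computable_on D c id f" "computable_on D c id g"
  shows "computable_on D c id (\<lambda>x. f x + g x)"
proof -
  have "computable_on D c id (\<lambda>x. rec_nat (f x) (\<lambda>_ r. Suc r) (g x))"
    by (rule computable_on_rec_nat_total assms computable_on_case_triple computable_on_Suc
        computable_on_proj)+
  moreover have "rec_nat a (\<lambda>_ r. Suc r) n = a + n" for a n
    by (induction n) auto
  ultimately show ?thesis by simp
qed

lemma computable_on_pred:
  assumes "computable_on D c id f"
  shows "computable_on D c id (\<lambda>x. f x - 1)"
proof -
  have "computable_on D c id (\<lambda>x. rec_nat 0 (\<lambda>y _. y) (f x))"
    by (rule computable_on_rec_nat_total assms computable_on_case_triple computable_on_const
        computable_on_proj)+
  moreover have "rec_nat 0 (\<lambda>y _. y) n = n - 1" for n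
    by (cases n) auto
  ultimately show ?thesis by simp
qed

lemma computable_on_diff:
  assumes "computable_on D c id f" "computable_on D c id g"
  shows "computable_on D c id (\<lambda>x. f x - g x)"
proof -
  have "computable_on D c id (\<lambda>x. rec_nat (f x) (\<lambda>_ r. r - 1) (g x))"
    by (rule computable_on_rec_nat_total assms computable_on_case_triple computable_on_pred
        computable_on_proj)+
  moreover have "rec_nat a (\<lambda>_ r. r - 1) n = a - n" for a n
    by (induction n) auto
  ultimately show ?thesis by simp
qed

lemma computable_on_eq_0:
  assumes "computable_on D c id f"
  shows "computable_on D c of_bool (\<lambda>x. f x = 0)"
proof -
  have "computable_on D c id (\<lambda>x. 1 - f x)"
    by (rule computable_on_diff assms computable_on_const)+
  then show ?thesis
    by (rule computable_on_recode) auto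
qed

lemma computable_on_eq_nat:
  assumes "computable_on D c id f" "computable_on D c id g"
  shows "computable_on D c of_bool (\<lambda>x. f x = g x)"
proof -
  have "computable_on D c of_bool (\<lambda>x. (f x - g x) + (g x - f x) = 0)"
    by (rule computable_on_eq_0 computable_on_add computable_on_diff assms)+
  then show ?thesis
    by (rule computable_on_cong) auto
qed

lemma computable_on_eq:
  assumes "computable_on D c d f" "computable_on D c d g" "inj_on d E"
    and "\<And>x. x \<in> D \<Longrightarrow> f x \<in> E \<and> g x \<in> E"
  shows "computable_on D c of_bool (\<lambda>x. f x = g x)"
proof -
  have "computable_on D c of_bool (\<lambda>x. d (f x) = d (g x))"
    by (rule computable_on_eq_nat[OF computable_on_code[OF assms(1)] computable_on_code[OF assms(2)]])
  then show ?thesis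
    by (rule computable_on_cong) (use assms in \<open>auto dest: inj_onD\<close>)
qed

lemma computable_on_power2:
  assumes "computable_on D c id f"
  shows "computable_on D c id (\<lambda>x. 2 ^ f x)"
proof -
  have "computable_on D c id (\<lambda>x. rec_nat 1 (\<lambda>_ r. r + r) (f x))"
    by (rule computable_on_rec_nat_total assms computable_on_case_triple computable_on_add
        computable_on_proj computable_on_const)+
  moreover have "rec_nat 1 (\<lambda>_ r. r + r) n = (2::nat) ^ n" for n
    by (induction n) auto
  ultimately show ?thesis by simp
qed

lemma computable_on_odd:
  assumes "computable_on D c id f"
  shows "computable_on D c of_bool (\<lambda>x. odd (f x))"
proof -
  have "computable_on D c of_bool (\<lambda>x. rec_nat False (\<lambda>_ r. \<not> r) (f x))"
    by (rule computable_on_rec_nat_total assms computable_on_case_triple computable_on_not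
        computable_on_proj computable_on_const)+
  moreover have "rec_nat False (\<lambda>_ r. \<not> r) n = odd n" for n
    by (induction n) auto
  ultimately show ?thesis by simp
qed

lemma computable_on_half:
  assumes "computable_on D c id f"
  shows "computable_on D c id (\<lambda>x. f x div 2)"
proof -
  \<comment> \<open>From \<open>y\<close> to \<open>Suc y\<close> the half grows exactly when
    \<open>y\<close> is odd.\<close>
  have "computable_on D c id (\<lambda>x. rec_nat 0 (\<lambda>y r. r + of_bool (odd y)) (f x))"
    by (rule computable_on_rec_nat_total assms computable_on_case_triple computable_on_add
        computable_on_proj computable_on_const computable_on_of_bool_iff[THEN iffD2]
        computable_on_odd)+
  moreover have "rec_nat 0 (\<lambda>y r. r + of_bool (odd y)) n = n div 2" for n :: nat
    by (induction n) auto
  ultimately show ?thesis by simp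
qed

text \<open>Parity after this shift is bit \<open>g x\<close> of \<open>f x\<close>, that is,
  membership of \<open>g x\<close> in the finite set with code \<open>f x\<close>.\<close>

lemma computable_on_div_power2:
  assumes "computable_on D c id f" "computable_on D c id g"
  shows "computable_on D c id (\<lambda>x. f x div 2 ^ g x)"
proof -
  have "computable_on D c id (\<lambda>x. rec_nat (f x) (\<lambda>_ r. r div 2) (g x))"
    by (rule computable_on_rec_nat_total assms computable_on_case_triple computable_on_half
        computable_on_proj)+
  moreover have "rec_nat a (\<lambda>_ r. r div 2) n = a div 2 ^ n" for a n :: nat
    by (induction n) (auto simp: power_Suc2 div_mult2_eq simp del: power_Suc)
  ultimately show ?thesis by simp
qed

subsection \<open>Lists\<close>

lemma computable_on_Cons:
  assumes "computable_on D c d f" "computable_on D c (list_code d) g"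
  shows "computable_on D c (list_code d) (\<lambda>x. f x # g x)"
proof -
  have "computable_on D c id (\<lambda>x. Suc (pair_code d (list_code d) (f x, g x)))"
    by (rule computable_on_Suc computable_on_code[OF computable_on_pair] assms)+
  then show ?thesis
    by (rule computable_on_recode) simp
qed

lemma computable_on_tl:
  assumes "computable_on D c (list_code d) f"
  shows "computable_on D c (list_code d) (\<lambda>x. tl (f x))"
proof -
  have "computable_on D c id (\<lambda>x. snd (prod_decode (list_code d (f x) - 1)))"
  proof (rule computable_on_comp_total[where g="\<lambda>n. snd (prod_decode n)" and d=id])
    show "computable_on UNIV id id (\<lambda>n. snd (prod_decode n))"
      by (rule computable_onI[OF partrec.right]) simp
    show "computable_on D c id (\<lambda>x. list_code d (f x) - 1)"
      by (rule computable_on_pred computable_on_code[OF assms(1)])+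
  qed
  then show ?thesis
  proof (rule computable_on_recode)
    fix x
    \<comment> \<open>For the empty list the truncated predecessor of the code 0 is again 0, whose
      second projection 0 codes \<open>tl [] = []\<close>; so one program covers both cases.\<close>
    have "prod_decode 0 = (0, 0)"
      by (simp add: prod_decode_def prod_decode_aux.simps)
    then show "list_code d (tl (f x)) = id (snd (prod_decode (list_code d (f x) - 1)))"
      by (cases "f x") simp_all
  qed
qed

lemma computable_on_hd:
  assumes "computable_on D c (list_code d) f" "\<And>x. x \<in> D \<Longrightarrow> f x \<noteq> []"
  shows "computable_on D c d (\<lambda>x. hd (f x))"
proof -
  have "computable_on D c id (\<lambda>x. fst (prod_decode (list_code d (f x) - 1)))"
  proof (rule computable_on_comp_total[where g="\<lambda>n. fst (prod_decode n)" and d=id])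
    show "computable_on UNIV id id (\<lambda>n. fst (prod_decode n))"
      by (rule computable_onI[OF partrec.left]) simp
    show "computable_on D c id (\<lambda>x. list_code d (f x) - 1)"
      by (rule computable_on_pred computable_on_code[OF assms(1)])+
  qed
  then show ?thesis
  proof (rule computable_on_recode)
    fix x assume "x \<in> D"
    then show "d (hd (f x)) = id (fst (prod_decode (list_code d (f x) - 1)))"
      using assms(2)[of x] by (cases "f x") simp_all
  qed
qed

lemma computable_on_drop:
  assumes "computable_on D c id n" "computable_on D c (list_code d) f"
  shows "computable_on D c (list_code d) (\<lambda>x. drop (n x) (f x))"
proof -
  have "computable_on D c (list_code d) (\<lambda>x. rec_nat (f x) (\<lambda>_ r. tl r) (n x))"
    by (rule computable_on_rec_nat_total assms computable_on_case_triple computable_on_tl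
        computable_on_proj)+
  moreover have "rec_nat xs (\<lambda>_ r. tl r) n = drop n xs" for xs :: "'b list" and n
    by (induction n) (auto simp: drop_Suc tl_drop)
  ultimately show ?thesis by simp
qed

lemma computable_on_Nil_iff:
  assumes "computable_on D c (list_code d) f"
  shows "computable_on D c of_bool (\<lambda>x. f x = [])"
proof -
  have "computable_on D c of_bool (\<lambda>x. list_code d (f x) = 0)"
    by (rule computable_on_eq_0 computable_on_code[OF assms(1)])+
  then show ?thesis
  proof (rule computable_on_cong)
    fix x show "(f x = []) = (list_code d (f x) = 0)"
      by (cases "f x") simp_all
  qed
qed

lemma computable_on_nth:
  assumes "computable_on D c (list_code d) f" "computable_on D c id n"
    and "\<And>x. x \<in> D \<Longrightarrow> n x < length (f x)"
  shows "computable_on D c d (\<lambda>x. f x ! n x)"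
proof -
  have "computable_on D c d (\<lambda>x. hd (drop (n x) (f x)))"
    by (rule computable_on_hd computable_on_drop assms)+ (use assms(3) in force)
  then show ?thesis
    by (rule computable_on_cong) (simp add: assms(3) hd_drop_conv_nth)
qed

text \<open>Codes of lists do not record the length; a search finds the first exhausted
  suffix.\<close>

lemma computable_on_length:
  assumes "computable_on D c (list_code d) f"
  shows "computable_on D c id (\<lambda>x. length (f x))"
proof -
  have "computable_on D c id (\<lambda>x. LEAST n. drop n (f x) = [])"
  proof (rule computable_on_Least)
    show "computable_on (D \<times> UNIV) (pair_code c id) of_bool (\<lambda>(x, n). drop n (f x) = [])"
      unfolding case_prod_unfold
      by (rule computable_on_Nil_iff computable_on_drop computable_on_proj
          computable_on_comp[OF assms computable_on_proj(1)])+ auto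
    show "\<exists>n. drop n (f x) = []" for x
      by auto
  qed
  moreover have "(LEAST n. drop n xs = []) = length xs" for xs :: "'b list"
    by (rule Least_equality) auto
  ultimately show ?thesis by simp
qed

lemma foldl_eq_rec_nat:
  "y \<le> length xs \<Longrightarrow> rec_nat a (\<lambda>i r. f r (xs ! i)) y = foldl f a (take y xs)"
  by (induction y) (auto simp: take_Suc_conv_app_nth)

text \<open>A fold is a recursion over positions. The invariant \<open>I\<close> describes the
  accumulators that can occur, and the step may rely on it; insertion into a coded set, for example,
  is available for finite sets.\<close>

lemma computable_on_foldl:
  assumes l: "computable_on D c (list_code e) l" and a: "computable_on D c h a"
    and s: "computable_on {(x, y, r). x \<in> D \<and> y \<in> set (l x) \<and> I x r}
      (pair_code c (pair_code e h)) h (\<lambda>(x, y, r). f x r y)"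
    and I: "\<And>x. x \<in> D \<Longrightarrow> I x (a x)"
      "\<And>x y r. x \<in> D \<Longrightarrow> y \<in> set (l x) \<Longrightarrow> I x r \<Longrightarrow> I x (f x r y)"
  shows "computable_on D c h (\<lambda>x. foldl (f x) (a x) (l x))"
proof -
  have inv: "I x (foldl (f x) b ys)" if "x \<in> D" "I x b" "set ys \<subseteq> set (l x)" for x b ys
    using that by (induction ys arbitrary: b) (auto intro: I(2))
  have "computable_on D c h (\<lambda>x. rec_nat (a x) (\<lambda>i r. f x r (l x ! i)) (length (l x)))"
  proof (rule computable_on_rec_nat[OF a])
    show "computable_on D c id (\<lambda>x. length (l x))"
      by (rule computable_on_length[OF l])
    let ?E = "{(x, i, r). x \<in> D \<and> i < length (l x) \<and>
      r = rec_nat (a x) (\<lambda>i r. f x r (l x ! i)) i}"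
    have "computable_on ?E (pair_code c (pair_code id h)) (pair_code c (pair_code e h))
      (\<lambda>z. (fst z, l (fst z) ! fst (snd z), snd (snd z)))"
      by (rule computable_on_pair computable_on_nth computable_on_proj
          computable_on_comp[OF l computable_on_proj(1)] | force)+
    from computable_on_comp[OF s this]
    show "computable_on ?E (pair_code c (pair_code id h)) h (\<lambda>(x, i, r). f x r (l x ! i))"
      by (auto simp: case_prod_unfold foldl_eq_rec_nat intro!: inv I(1) dest: in_set_takeD)
  qed
  then show ?thesis
    by (rule computable_on_cong) (simp add: foldl_eq_rec_nat)
qed

lemma computable_on_foldl_total:
  assumes "computable_on D c (list_code e) l" "computable_on D c h a"
    and "computable_on {z. fst z \<in> D \<and> fst (snd z) \<in> set (l (fst z))}
      (pair_code c (pair_code e h)) h (\<lambda>z. f (fst z) (snd (snd z)) (fst (snd z)))"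
  shows "computable_on D c h (\<lambda>x. foldl (f x) (a x) (l x))"
  by (rule computable_on_foldl[where I="\<lambda>_ _. True", OF assms(1,2)])
    (use assms(3) in \<open>simp_all add: case_prod_unfold\<close>)

lemma computable_on_rev:
  assumes "computable_on D c (list_code d) f"
  shows "computable_on D c (list_code d) (\<lambda>x. rev (f x))"
proof -
  have "computable_on D c (list_code d) (\<lambda>x. foldl (\<lambda>r y. y # r) [] (f x))"
    by (rule computable_on_foldl_total assms computable_on_const computable_on_Cons
        computable_on_proj)+
  moreover have "foldl (\<lambda>r y. y # r) ys xs = rev xs @ ys" for xs ys :: "'b list"
    by (induction xs arbitrary: ys) auto
  ultimately show ?thesis by simp
qed

lemma computable_on_append:
  assumes "computable_on D c (list_code d) f" "computable_on D c (list_code d) g"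
  shows "computable_on D c (list_code d) (\<lambda>x. f x @ g x)"
proof -
  have "computable_on D c (list_code d) (\<lambda>x. foldl (\<lambda>r y. y # r) (g x) (rev (f x)))"
    by (rule computable_on_foldl_total computable_on_rev assms computable_on_const
        computable_on_Cons computable_on_proj)+
  moreover have "foldl (\<lambda>r y. y # r) ys xs = rev xs @ ys" for xs ys :: "'b list"
    by (induction xs arbitrary: ys) auto
  ultimately show ?thesis by simp
qed

lemma computable_on_map:
  assumes l: "computable_on D c (list_code d) l"
    and f: "computable_on (SIGMA x:D. set (l x)) (pair_code c d) e (\<lambda>z. f (fst z) (snd z))"
  shows "computable_on D c (list_code e) (\<lambda>x. map (f x) (l x))"
proof -
  let ?E = "{z. fst z \<in> D \<and> fst (snd z) \<in> set (l (fst z))}"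
  have "computable_on ?E (pair_code c (pair_code d (list_code e))) (pair_code c d)
    (\<lambda>z. (fst z, fst (snd z)))"
    by (rule computable_on_pair computable_on_proj)+
  from computable_on_comp[OF f this]
  have f': "computable_on ?E (pair_code c (pair_code d (list_code e))) e
    (\<lambda>z. f (fst z) (fst (snd z)))"
    by auto
  have "computable_on D c (list_code e) (\<lambda>x. rev (foldl (\<lambda>r y. f x y # r) [] (l x)))"
    by (rule computable_on_rev computable_on_foldl_total l computable_on_const
      computable_on_Cons f' computable_on_proj)+
  moreover have "foldl (\<lambda>r y. g y # r) ys xs = rev (map g xs) @ ys" for g and xs :: "'b list" and ys :: "'c list"
    by (induction xs arbitrary: ys) auto
  ultimately show ?thesis by simp
qed

lemma computable_on_concat:
  assumes "computable_on D c (list_code (list_code d)) f"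
  shows "computable_on D c (list_code d) (\<lambda>x. concat (f x))"
proof -
  have "computable_on D c (list_code d) (\<lambda>x. foldl (\<lambda>r y. r @ y) [] (f x))"
    by (rule computable_on_foldl_total assms computable_on_const computable_on_append
        computable_on_proj)+
  moreover have "foldl (\<lambda>r y. r @ y) ys xs = ys @ concat xs" for xs and ys :: "'b list"
    by (induction xs arbitrary: ys) auto
  ultimately show ?thesis by simp
qed

lemma computable_on_filter:
  assumes l: "computable_on D c (list_code d) l"
    and P: "computable_on (SIGMA x:D. set (l x)) (pair_code c d) of_bool (\<lambda>z. P (fst z) (snd z))"
  shows "computable_on D c (list_code d) (\<lambda>x. filter (P x) (l x))"
proof -
  have "computable_on D c (list_code d) (\<lambda>x. concat (map (\<lambda>y. if P x y then [y] else []) (l x)))"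
    by (rule computable_on_concat computable_on_map computable_on_if_total l P computable_on_Cons
        computable_on_const computable_on_proj)+
  moreover have "concat (map (\<lambda>y. if Q y then [y] else []) xs) = filter Q xs" for Q and xs :: "'b list"
    by (induction xs) auto
  ultimately show ?thesis by simp
qed

lemma computable_on_ex:
  assumes l: "computable_on D c (list_code d) l"
    and P: "computable_on (SIGMA x:D. set (l x)) (pair_code c d) of_bool (\<lambda>z. P (fst z) (snd z))"
  shows "computable_on D c of_bool (\<lambda>x. \<exists>y\<in>set (l x). P x y)"
proof -
  have "computable_on D c of_bool (\<lambda>x. \<not> filter (P x) (l x) = [])"
    by (rule computable_on_not computable_on_Nil_iff computable_on_filter l P)+
  then show ?thesis
    by (rule computable_on_cong) (simp add: filter_empty_conv)
qed

text \<open>\<open>product_lists\<close> is built up from the last factor to the first, hence a left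
  fold over the reversed list.\<close>

lemma computable_on_product_lists:
  assumes "computable_on D c (list_code (list_code d)) f"
  shows "computable_on D c (list_code (list_code d)) (\<lambda>x. product_lists (f x))"
proof -
  have *: "computable_on E e (list_code (list_code d)) (\<lambda>x. map (\<lambda>zs. g x # zs) (h x))"
    if "computable_on E e d g" "computable_on E e (list_code (list_code d)) h"
    for E e and g :: "'x \<Rightarrow> 'b" and h
    by (rule computable_on_map that computable_on_Cons computable_on_proj
        computable_on_comp[OF that(1)] | force)+
  have "computable_on D c (list_code (list_code d))
    (\<lambda>x. foldl (\<lambda>r ys. concat (map (\<lambda>y. map (\<lambda>zs. y # zs) r) ys)) [[]] (rev (f x)))"
    by (rule computable_on_foldl_total computable_on_rev assms computable_on_const
      computable_on_concat computable_on_map[where f="\<lambda>z y. map ((#) y) (snd (snd z))"] *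
      computable_on_proj computable_on_snd[OF computable_on_snd[OF computable_on_fst_arg]])+
  moreover have "foldl (\<lambda>r ys. concat (map (\<lambda>y. map (\<lambda>zs. y # zs) r) ys)) [[]] (rev xss)
      = product_lists xss" for xss :: "'b list list"
    by (induction xss) auto
  ultimately show ?thesis by simp
qed

lemma computable_on_upt:
  assumes "computable_on D c id n"
  shows "computable_on D c (list_code id) (\<lambda>x. [0..<n x])"
proof -
  have "computable_on D c (list_code id) (\<lambda>x. rec_nat [] (\<lambda>y r. r @ [y]) (n x))"
    by (rule computable_on_rec_nat_total assms computable_on_const computable_on_case_triple
        computable_on_append computable_on_Cons computable_on_proj)+
  moreover have "rec_nat [] (\<lambda>y r. r @ [y]) n = [0..<n]" for n
    by (induction n) auto
  ultimately show ?thesis by simp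
qed

text \<open>Primitive recursion passes on only the previous value, while the components of a code
  may be any smaller numbers. Recursing on the table of all earlier values makes every one of them
  available.\<close>

lemma computable_on_course_of_values:
  assumes G: "computable_on UNIV (pair_code id (list_code id)) id (\<lambda>(n, xs). G n xs)"
  obtains F where "computable_on UNIV id id F" "\<And>n. F n = G n (map F [0..<n])"
proof
  define R where "R = rec_nat [] (\<lambda>n xs. xs @ [G n xs])"
  define F where "F n = G n (R n)" for n
  have R: "R n = map F [0..<n]" for n
    by (induction n) (auto simp: R_def F_def)
  show "F n = G n (map F [0..<n])" for n
    by (simp add: F_def R)
  have "computable_on UNIV (pair_code id (pair_code id (list_code id))) id
    (\<lambda>z. (\<lambda>(n, xs). G n xs) (snd z))"
    by (rule computable_on_comp_total[OF G]) (rule computable_on_proj)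
  then have G': "computable_on UNIV (pair_code id (pair_code id (list_code id))) id
    (\<lambda>z. G (fst (snd z)) (snd (snd z)))"
    by (simp add: case_prod_unfold)
  have "computable_on UNIV id (list_code id) (\<lambda>n. rec_nat [] (\<lambda>n xs. xs @ [G n xs]) n)"
    by (rule computable_on_rec_nat_total computable_on_const computable_on_id
      computable_on_case_triple computable_on_append computable_on_Cons G' computable_on_proj)+
  then have "computable_on UNIV id (pair_code id (list_code id)) (\<lambda>n. (n, R n))"
    unfolding R_def by (intro computable_on_pair computable_on_id)
  from computable_on_comp_total[OF G this] show "computable_on UNIV id id F"
    by (simp add: F_def[abs_def])
qed

subsection \<open>Finite sets\<close>

lemma computable_on_insert:
  assumes "computable_on D c id f" "computable_on D c set_encode A" "\<And>x. x \<in> D \<Longrightarrow> finite (A x)"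
  shows "computable_on D c set_encode (\<lambda>x. insert (f x) (A x))"
proof -
  have A: "computable_on D c id (\<lambda>x. set_encode (A x))"
    using assms(2) by (rule computable_on_code)
  \<comment> \<open>Adding the power of 2 is correct only for a new element; for an old one it would
    carry into other bits.\<close>
  have "computable_on D c id (\<lambda>x. if odd (set_encode (A x) div 2 ^ f x) then set_encode (A x)
      else 2 ^ f x + set_encode (A x))"
    by (rule computable_on_if_total computable_on_odd computable_on_div_power2 computable_on_add
        computable_on_power2 assms(1) A)+
  then show ?thesis
  proof (rule computable_on_recode)
    fix x assume x: "x \<in> D"
    have "f x \<in> A x \<longleftrightarrow> odd (set_encode (A x) div 2 ^ f x)"
      using set_encode_inverse[OF assms(3)[OF x]] by (auto simp: set_decode_def)
    then show "set_encode (insert (f x) (A x)) =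
      id (if odd (set_encode (A x) div 2 ^ f x) then set_encode (A x)
        else 2 ^ f x + set_encode (A x))"
      using assms(3)[OF x] by (auto simp: insert_absorb set_encode_insert)
  qed
qed

lemma computable_on_set:
  assumes "computable_on D c (list_code id) f"
  shows "computable_on D c set_encode (\<lambda>x. set (f x))"
proof -
  have "computable_on D c set_encode (\<lambda>x. foldl (\<lambda>A y. insert y A) {} (f x))"
  proof (rule computable_on_foldl[where I="\<lambda>_. finite", OF assms computable_on_const])
    show "computable_on {(x, y, A). x \<in> D \<and> y \<in> set (f x) \<and> finite A}
      (pair_code c (pair_code id set_encode)) set_encode (\<lambda>(x, y, A). insert y A)"
      by (rule computable_on_case_triple computable_on_insert computable_on_proj)+ auto
  qed auto
  moreover have "foldl (\<lambda>A y. insert y A) B xs = B \<union> set xs" for B and xs :: "nat list"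
    by (induction xs arbitrary: B) auto
  ultimately show ?thesis by simp
qed

lemma computable_on_sorted_list_of_set:
  "computable_on (Collect finite) set_encode (list_code id) sorted_list_of_set"
proof -
  \<comment> \<open>The code is its own search bound, since a member \<open>i\<close> contributes
    \<open>2 ^ i\<close> to it and \<open>i < 2 ^ i\<close>.\<close>
  have "computable_on (Collect finite) set_encode (list_code id)
    (\<lambda>A. filter (\<lambda>i. odd (set_encode A div 2 ^ i)) [0..<set_encode A])"
    by (rule computable_on_filter computable_on_upt computable_on_odd computable_on_div_power2
        computable_on_proj computable_on_code[OF computable_on_id]
        computable_on_code[OF computable_on_fst_arg])+
  then show ?thesis
  proof (rule computable_on_cong)
    fix A :: "nat set" assume "A \<in> Collect finite"
    then have A: "finite A" by simp
    have mem: "odd (set_encode A div 2 ^ i) \<longleftrightarrow> i \<in> A" for i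
      using set_encode_inverse[OF A] by (auto simp: set_decode_def)
    have lt: "i < set_encode A" if "i \<in> A" for i
    proof -
      have "i < 2 ^ i" by (rule less_exp)
      also have "2 ^ i \<le> set_encode A"
        unfolding set_encode_def using A that
        by (intro member_le_sum) auto
      finally show ?thesis .
    qed
    show "sorted_list_of_set A = filter (\<lambda>i. odd (set_encode A div 2 ^ i)) [0..<set_encode A]"
      unfolding mem
      by (rule sorted_distinct_set_unique) (use A lt in \<open>auto simp: sorted_wrt_filter\<close>)
  qed
qed

text \<open>Every key in \<open>K\<close> may have its own program, with no uniformity between them;
  finitely many tests of the key combine them into one. With the predicate symbol of a state as the
  key, this is where finiteness of \<open>rels Q\<close> enters.\<close>

lemma computable_on_case_finite:
  assumes "finite K" "computable_on D c d k" "inj_on d K" "\<And>x. x \<in> D \<Longrightarrow> k x \<in> K"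
    and "\<And>q. q \<in> K \<Longrightarrow> computable_on {x \<in> D. k x = q} c e f"
  shows "computable_on D c e f"
  using assms
proof (induction K arbitrary: D rule: finite_induct)
  case empty
  then have "D = {}" by auto
  then show ?case
    by (auto intro: computable_onI[OF partrec.zero])
next
  case (insert q K)
  \<comment> \<open>Both branches give \<open>f x\<close>, but by different programs.\<close>
  have "computable_on D c e (\<lambda>x. if k x = q then f x else f x)"
  proof (rule computable_on_if)
    show "computable_on D c of_bool (\<lambda>x. k x = q)"
      by (rule computable_on_eq[OF insert.prems(1) computable_on_const insert.prems(2)])
        (use insert.prems(3) in auto)
    show "computable_on {x \<in> D. k x = q} c e f"
      by (rule insert.prems) simp
    show "computable_on {x \<in> D. k x \<noteq> q} c e f"
    proof (rule insert.IH)
      show "computable_on {x \<in> D. k x \<noteq> q} c d k"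
        by (rule computable_on_subset[OF insert.prems(1)]) auto
      fix p assume "p \<in> K"
      then show "computable_on {x \<in> {x \<in> D. k x \<noteq> q}. k x = p} c e f"
        by (intro computable_on_subset[OF insert.prems(4)[of p]]) auto
    qed (use insert.prems in auto)
  qed
  then show ?case by simp
qed

section \<open>Translating formulas into formulas with constants\<close>

text \<open>A number is the code of the pair that it decodes to, so decoding leaves the code
  alone.\<close>

lemma computable_on_prod_decode:
  "computable_on D c id f \<Longrightarrow> computable_on D c (pair_code id id) (\<lambda>x. prod_decode (f x))"
  by (erule computable_on_recode) (simp add: pair_code_def)

lemma computable_on_prod_encode:
  "computable_on D c id f \<Longrightarrow> computable_on D c id g \<Longrightarrow>
    computable_on D c id (\<lambda>x. prod_encode (f x, g x))"
  by (rule computable_on_recode[OF computable_on_pair[where d=id and e=id]]) simp_all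

lemma computable_on_list_decode:
  "computable_on D c id f \<Longrightarrow> computable_on D c (list_code id) (\<lambda>x. list_decode (f x))"
  by (erule computable_on_recode) simp

lemma computable_on_list_encode:
  "computable_on D c (list_code id) f \<Longrightarrow> computable_on D c id (\<lambda>x. list_encode (f x))"
  by (erule computable_on_recode) simp

text \<open>The default 0 makes this total: the step of a course-of-values recursion has to be
  computable at all numbers, also at those that code no term or formula.\<close>

definition lookup :: "nat list \<Rightarrow> nat \<Rightarrow> nat" where
  "lookup xs i = (if drop i xs = [] then 0 else hd (drop i xs))"

lemma lookup_map_upt [simp]: "i < n \<Longrightarrow> lookup (map F [0..<n]) i = F i"
  by (simp add: lookup_def hd_drop_conv_nth)

lemma computable_on_lookup:
  assumes "computable_on D c (list_code id) f" "computable_on D c id g"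
  shows "computable_on D c id (\<lambda>x. lookup (f x) (g x))"
  unfolding lookup_def
proof (rule computable_on_if)
  have d: "computable_on D c (list_code id) (\<lambda>x. drop (g x) (f x))"
    by (rule computable_on_drop assms)+
  show "computable_on D c of_bool (\<lambda>x. drop (g x) (f x) = [])"
    by (rule computable_on_Nil_iff[OF d])
  show "computable_on {x \<in> D. drop (g x) (f x) \<noteq> []} c id (\<lambda>x. hd (drop (g x) (f x)))"
    by (rule computable_on_hd[OF computable_on_subset[OF d]]) auto
qed (rule computable_on_const)

lemma less_list_encode: "x \<in> set xs \<Longrightarrow> x < list_encode xs"
  by (induction xs) (auto simp: less_Suc_eq_le le_prod_encode_1
      intro: order.trans[OF less_imp_le le_prod_encode_2])

text \<open>A positive tag pushes a code strictly above its payload, so the table of earlier values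
  has entries for the components. With tag 0 this fails, as
  \<open>prod_encode (0, 0) = 0\<close>.\<close>

lemma less_prod_encode_snd:
  assumes "0 < k" shows "m < prod_encode (k, m)"
proof -
  have "n \<le> triangle n" for n
    by (induction n) auto
  from this[of "k + m"] show ?thesis
    using assms by (simp add: prod_encode_def)
qed

definition embed_qf :: "('f, 'r) qf \<Rightarrow> ('f + 'a, 'r) qf" where
  "embed_qf = map_form (map_atom Inl id)"

lemma const_code_simps [simp]:
  "const_code cf ca (Inl f) = cf f + cf f" "const_code cf ca (Inr a) = Suc (ca a + ca a)"
  by (simp_all add: const_code_def sum_encode_def)

lemma computable_embed_tm:
  fixes cf :: "'f \<Rightarrow> nat" and ca :: "'a \<Rightarrow> nat"
  obtains F where "computable_on UNIV id id F"
    "\<And>t. F (tm_code cf t) = tm_code (const_code cf ca) (map_tm Inl t)"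
proof -
  \<comment> \<open>Tag 0 is a variable and stays. For an application the symbol code is doubled,
    which is the effect of \<open>Inl\<close> on codes, and the arguments are replaced by their
    entries in the table.\<close>
  define G where "G n xs = (if fst (prod_decode n) = 0 then n else
    prod_encode (1, prod_encode
      (fst (prod_decode (snd (prod_decode n))) + fst (prod_decode (snd (prod_decode n))),
       list_encode (map (\<lambda>m. lookup xs m) (list_decode (snd (prod_decode (snd (prod_decode n)))))))))"
    for n xs
  have "computable_on UNIV (pair_code id (list_code id)) id (\<lambda>(n, xs). G n xs)"
    unfolding case_prod_unfold G_def
    by (rule computable_on_if_total computable_on_eq_0 computable_on_prod_encode
        computable_on_list_encode computable_on_map computable_on_list_decode computable_on_lookup
        computable_on_add computable_on_const
        computable_on_proj computable_on_fst[OF computable_on_prod_decode]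
        computable_on_snd[OF computable_on_prod_decode]
        computable_on_snd[OF computable_on_fst_arg])+
  then obtain F where F: "computable_on UNIV id id F" and F_eq: "\<And>n. F n = G n (map F [0..<n])"
    by (rule computable_on_course_of_values) blast
  have "F (tm_code cf t) = tm_code (const_code cf ca) (map_tm Inl t)" for t
  proof (induction t)
    case (Var i)
    then show ?case by (subst F_eq) (simp add: G_def)
  next
    case (Fun f ts)
    let ?n = "tm_code cf (Fun f ts)"
    have lt: "tm_code cf t < ?n" if "t \<in> set ts" for t
    proof -
      have "tm_code cf t < list_encode (map (tm_code cf) ts)"
        using that by (intro less_list_encode) auto
      also have "\<dots> \<le> prod_encode (cf f, list_encode (map (tm_code cf) ts))"
        by (rule le_prod_encode_2)
      also have "\<dots> < ?n"
        by (simp add: less_prod_encode_snd)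
      finally show ?thesis .
    qed
    have "map (\<lambda>m. lookup (map F [0..<?n]) m) (map (tm_code cf) ts) =
        map (\<lambda>t. tm_code (const_code cf ca) (map_tm Inl t)) ts"
      using lt Fun.IH by simp
    then have "map (\<lambda>t. lookup (map F [0..<?n]) (tm_code cf t)) ts =
        map (\<lambda>t. tm_code (const_code cf ca) (map_tm Inl t)) ts"
      by (simp add: comp_def)
    then show ?case
      by (subst F_eq) (simp add: G_def comp_def cong: map_cong)
  qed
  with F show thesis by (rule that)
qed

lemma computable_embed_atom:
  fixes cf :: "'f \<Rightarrow> nat" and cr :: "'r \<Rightarrow> nat" and ca :: "'a \<Rightarrow> nat"
  obtains F where "computable_on UNIV id id F"
    "\<And>p. F (atom_code cf cr p) = atom_code (const_code cf ca) cr (map_atom Inl id p)"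
proof -
  obtain E where E: "computable_on UNIV id id E"
    and E_eq: "\<And>t. E (tm_code cf t) = tm_code (const_code cf ca) (map_tm Inl t)"
    by (rule computable_embed_tm) blast
  define F where "F n = (if fst (prod_decode n) = 0
    then prod_encode (0, prod_encode (E (fst (prod_decode (snd (prod_decode n)))),
      E (snd (prod_decode (snd (prod_decode n))))))
    else prod_encode (1, prod_encode (fst (prod_decode (snd (prod_decode n))),
      list_encode (map (\<lambda>m. E m) (list_decode (snd (prod_decode (snd (prod_decode n)))))))))" for n
  have "computable_on UNIV id id (\<lambda>n. F n)"
    unfolding F_def
    by (rule computable_on_if_total computable_on_eq_0 computable_on_prod_encode
        computable_on_list_encode computable_on_map computable_on_list_decode computable_on_const
        computable_on_proj computable_on_fst[OF computable_on_prod_decode]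
        computable_on_snd[OF computable_on_prod_decode] computable_on_id
        computable_on_comp_total[OF E])+
  moreover have "F (atom_code cf cr p) = atom_code (const_code cf ca) cr (map_atom Inl id p)" for p
    by (cases p) (simp_all add: F_def E_eq o_def)
  ultimately show thesis by (rule that)
qed

lemma computable_on_embed_qf:
  "computable_on UNIV (qf_code cf cr) (qf_code (const_code cf ca) cr) embed_qf"
proof -
  obtain E where E: "computable_on UNIV id id E"
    and E_eq: "\<And>p. E (atom_code cf cr p) =
      atom_code (const_code cf ca) cr (map_atom Inl id p)"
    by (rule computable_embed_atom) blast
  \<comment> \<open>Tags 0 and 1 are the truth constants, 2 is an atom, 3 a negation. The last
    branch keeps its tag and serves conjunction and disjunction alike.\<close>
  define G where "G n xs = (if fst (prod_decode n) = 0 then n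
    else if fst (prod_decode n) = 1 then n
    else if fst (prod_decode n) = 2 then prod_encode (2, E (snd (prod_decode n)))
    else if fst (prod_decode n) = 3 then prod_encode (3, lookup xs (snd (prod_decode n)))
    else prod_encode (fst (prod_decode n), prod_encode
      (lookup xs (fst (prod_decode (snd (prod_decode n)))),
       lookup xs (snd (prod_decode (snd (prod_decode n)))))))" for n xs
  have "computable_on UNIV (pair_code id (list_code id)) id (\<lambda>(n, xs). G n xs)"
    unfolding case_prod_unfold G_def
    by (rule computable_on_if_total computable_on_eq_nat computable_on_prod_encode
        computable_on_lookup computable_on_const
        computable_on_proj computable_on_fst[OF computable_on_prod_decode]
        computable_on_snd[OF computable_on_prod_decode]
        computable_on_comp_total[OF E])+
  then obtain F where F: "computable_on UNIV id id F" and F_eq: "\<And>n. F n = G n (map F [0..<n])"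
    by (rule computable_on_course_of_values) blast
  have lt: "m < prod_encode (Suc k, prod_encode (m, n))"
    "n < prod_encode (Suc k, prod_encode (m, n))" for k m n
    using le_prod_encode_1[of m n] le_prod_encode_2[of n m]
      less_prod_encode_snd[of "Suc k" "prod_encode (m, n)"] by linarith+
  have lt': "m < prod_encode (numeral k, prod_encode (m, n))"
    "n < prod_encode (numeral k, prod_encode (m, n))" for k m n
    using lt(1)[of m "pred_numeral k" n] lt(2)[of n "pred_numeral k" m] by (simp_all add: numeral_eq_Suc)
  have "F (qf_code cf cr \<phi>) = qf_code (const_code cf ca) cr (embed_qf \<phi>)" for \<phi>
  proof (induction \<phi>)
    case Tru
    then show ?case by (subst F_eq) (simp add: G_def qf_code_def embed_qf_def)
  next
    case Fls
    then show ?case by (subst F_eq) (simp add: G_def qf_code_def embed_qf_def)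
  next
    case (Atom p)
    then show ?case by (subst F_eq) (simp add: G_def qf_code_def embed_qf_def E_eq)
  next
    case (Neg \<phi>)
    then show ?case
      by (subst F_eq) (simp add: G_def qf_code_def embed_qf_def less_prod_encode_snd)
  next
    case (Conj \<phi> \<psi>)
    then show ?case
      by (subst F_eq) (simp add: G_def qf_code_def embed_qf_def lt')
  next
    case (Disj \<phi> \<psi>)
    then show ?case
      by (subst F_eq) (simp add: G_def qf_code_def embed_qf_def lt')
  qed
  with F show ?thesis
    by (auto simp: computable_on_def)
qed

section \<open>Evaluating formulas with the satisfiability oracle\<close>

text \<open>Conjoining equations, rather than substituting constants, leaves the formula itself
  merely renamed. Variables from \<open>length as\<close> on stay free, so satisfiability quantifies
  over them existentially.\<close>

definition pin :: "'a list \<Rightarrow> ('f, 'r) qf \<Rightarrow> ('f + 'a, 'r) qf" where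
  "pin as \<phi> = foldl (\<lambda>\<psi> i. Conj \<psi> (Atom (Eq (Var i) (Fun (Inr (as ! i)) []))))
     (embed_qf \<phi>) [0..<length as]"

lemma computable_on_pin:
  "computable_on UNIV (pair_code (list_code ca) (qf_code cf cr)) (qf_code (const_code cf ca) cr)
    (\<lambda>z. pin (fst z) (snd z))"
  unfolding pin_def
proof (rule computable_on_foldl_total)
  show "computable_on UNIV (pair_code (list_code ca) (qf_code cf cr)) (list_code id)
    (\<lambda>z. [0..<length (fst z)])"
    by (rule computable_on_upt computable_on_length computable_on_proj)+
  show "computable_on UNIV (pair_code (list_code ca) (qf_code cf cr))
    (qf_code (const_code cf ca) cr) (\<lambda>z. embed_qf (snd z))"
    by (rule computable_on_comp_total[OF computable_on_embed_qf]) (rule computable_on_proj)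
  let ?D = "{z :: ('a list \<times> ('b, 'c) qf) \<times> nat \<times> ('b + 'a, 'c) qf. fst z \<in> UNIV \<and>
    fst (snd z) \<in> set [0..<length (fst (fst z))]}"
  let ?c = "pair_code (pair_code (list_code ca) (qf_code cf cr))
    (pair_code id (qf_code (const_code cf ca) cr))"
  have "computable_on ?D ?c ca (\<lambda>z. fst (fst z) ! fst (snd z))"
    by (rule computable_on_nth[OF computable_on_fst[OF computable_on_fst_arg]
        computable_on_fst_snd_arg]) auto
  then have n: "computable_on ?D ?c id (\<lambda>z. ca (fst (fst z) ! fst (snd z)))"
    by (rule computable_on_code)
  have \<psi>: "computable_on ?D ?c id (\<lambda>z. qf_code (const_code cf ca) cr (snd (snd z)))"
    by (rule computable_on_code) (rule computable_on_proj)
  \<comment> \<open>The tags 4, 2 and 0 stand for \<open>Conj\<close>, \<open>Atom\<close> and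
    \<open>Eq\<close>, then 0 for \<open>Var\<close> and 1 for \<open>Fun\<close>. The successor of
    the doubled element code is the code of the constant, and the final 0 is its empty argument
    list.\<close>
  have "computable_on ?D ?c id (\<lambda>z. prod_encode (4, prod_encode
    (qf_code (const_code cf ca) cr (snd (snd z)), prod_encode (2, prod_encode (0, prod_encode
      (prod_encode (0, fst (snd z)), prod_encode (1, prod_encode
        (Suc (ca (fst (fst z) ! fst (snd z)) + ca (fst (fst z) ! fst (snd z))), 0))))))))"
    by (rule computable_on_prod_encode computable_on_Suc computable_on_add n \<psi>
        computable_on_fst_snd_arg computable_on_const)+
  then show "computable_on ?D ?c (qf_code (const_code cf ca) cr)
    (\<lambda>z. Conj (snd (snd z)) (Atom (Eq (Var (fst (snd z))) (Fun (Inr (fst (fst z) ! fst (snd z))) []))))"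
    by (rule computable_on_recode) (simp add: qf_code_def)
qed

lemma wf_embed_tm: "wf_tm V t \<Longrightarrow> wf_tm (const_vocab V T) (map_tm Inl t)"
  by (induction t) (auto simp: const_vocab_def list_all_iff)

lemma embed_qf_in_qf_formulas:
  assumes "\<phi> \<in> qf_formulas V" shows "embed_qf \<phi> \<in> qf_formulas (const_vocab V T)"
proof -
  have "wf_atom (const_vocab V T) (map_atom Inl id p)" if "wf_atom V p" for p
    using that by (cases p) (auto simp: wf_embed_tm, auto simp: const_vocab_def)
  then show ?thesis
    using assms by (auto simp: qf_formulas_def embed_qf_def form.set_map)
qed

lemma pin_in_qf_formulas:
  assumes "set as \<subseteq> univ T" "\<phi> \<in> qf_formulas V"
  shows "pin as \<phi> \<in> qf_formulas (const_vocab V T)"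
proof -
  have *: "foldl (\<lambda>\<psi> i. Conj \<psi> (Atom (Eq (Var i) (Fun (Inr (as ! i)) [])))) \<psi> is
      \<in> qf_formulas (const_vocab V T)"
    if "\<psi> \<in> qf_formulas (const_vocab V T)" "set is \<subseteq> {..<length as}" for \<psi> "is"
    using that
  proof (induction "is" arbitrary: \<psi>)
    case (Cons i "is")
    show ?case
      unfolding foldl_Cons
    proof (rule Cons.IH)
      have "as ! i \<in> univ T"
        using Cons.prems assms(1) by auto
      then show "Conj \<psi> (Atom (Eq (Var i) (Fun (Inr (as ! i)) []))) \<in> qf_formulas (const_vocab V T)"
        using Cons.prems by (auto simp: qf_formulas_def const_vocab_def)
    qed (use Cons.prems in auto)
  qed simp
  show ?thesis
    unfolding pin_def by (rule * embed_qf_in_qf_formulas assms)+ auto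
qed

lemma eval_embed_tm [simp]: "eval_tm (const_struct T) \<nu> (map_tm Inl t) = eval_tm T \<nu> t"
  by (induction t) (auto simp: const_struct_def intro!: arg_cong[where f="fint T _"])

lemma holds_embed_qf [simp]: "holds (const_struct T) \<nu> (embed_qf \<phi>) \<longleftrightarrow> holds T \<nu> \<phi>"
proof -
  have "atom_holds (const_struct T) \<nu> (map_atom Inl id p) \<longleftrightarrow> atom_holds T \<nu> p" for p
    by (cases p) (simp_all add: o_def, simp add: const_struct_def)
  then show ?thesis
    by (induction \<phi>) (simp_all add: embed_qf_def)
qed

lemma holds_pin:
  "holds (const_struct T) \<nu> (pin as \<phi>) \<longleftrightarrow> holds T \<nu> \<phi> \<and> (\<forall>i<length as. \<nu> i = as ! i)"
proof -
  have "holds (const_struct T) \<nu> (foldl (\<lambda>\<psi> i. Conj \<psi> (Atom (Eq (Var i) (Fun (Inr (as ! i)) [])))) \<psi> is)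
    \<longleftrightarrow> holds (const_struct T) \<nu> \<psi> \<and> (\<forall>i\<in>set is. \<nu> i = as ! i)" for \<psi> "is"
    by (induction "is" arbitrary: \<psi>) (auto simp: const_struct_def)
  then show ?thesis
    by (auto simp: pin_def)
qed

definition sat :: "('f, 'r, 'a) struct \<Rightarrow> 'a list \<Rightarrow> ('f, 'r) qf \<Rightarrow> bool" where
  "sat T as \<phi> \<longleftrightarrow> satisfiable (const_struct T) (pin as \<phi>)"

lemma sat_iff:
  "sat T as \<phi> \<longleftrightarrow> (\<exists>\<nu>. range \<nu> \<subseteq> univ T \<and> (\<forall>i<length as. \<nu> i = as ! i) \<and> holds T \<nu> \<phi>)"
proof -
  have "univ (const_struct T) = univ T"
    by (simp add: const_struct_def)
  then show ?thesis
    by (auto simp: sat_def satisfiable_def holds_pin)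
qed

lemma eval_tm_cong: "(\<And>i. i \<in> tm_vars t \<Longrightarrow> \<nu> i = \<mu> i) \<Longrightarrow> eval_tm T \<nu> t = eval_tm T \<mu> t"
proof (induction t)
  case (Fun f ts)
  have "map (eval_tm T \<nu>) ts = map (eval_tm T \<mu>) ts"
    using Fun by (intro map_cong refl) auto
  then show ?case
    unfolding eval_tm.simps by (rule arg_cong)
qed simp

lemma holds_cong:
  assumes "\<And>i. i \<in> free_vars \<phi> \<Longrightarrow> \<nu> i = \<mu> i"
  shows "holds T \<nu> \<phi> \<longleftrightarrow> holds T \<mu> \<phi>"
  using assms
proof (induction \<phi>)
  case (Atom p)
  show ?case
  proof (cases p)
    case (Eq s t)
    have "eval_tm T \<nu> s = eval_tm T \<mu> s" "eval_tm T \<nu> t = eval_tm T \<mu> t"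
      by (auto intro!: eval_tm_cong Atom simp: free_vars_def Eq)
    then show ?thesis by (simp add: Eq)
  next
    case (Rel r ts)
    have "map (eval_tm T \<nu>) ts = map (eval_tm T \<mu>) ts"
      by (auto intro!: eval_tm_cong Atom simp: free_vars_def Rel)
    then show ?thesis
      by (simp only: Rel holds.simps atom_holds.simps)
  qed
qed (auto simp: free_vars_def)

text \<open>The variable just after the tuple is left unpinned, which turns the oracle into a test
  whether some letter completes the tuple.\<close>

lemma sat_iff_ex_holds:
  assumes "set as \<subseteq> univ T" and "free_vars \<phi> \<subseteq> {..<Suc (length as)}"
  shows "sat T as \<phi> \<longleftrightarrow> (\<exists>x\<in>univ T. holds T (\<lambda>i. (as @ [x]) ! i) \<phi>)"
proof
  assume "sat T as \<phi>"
  then obtain \<nu> where \<nu>: "range \<nu> \<subseteq> univ T" "\<forall>i<length as. \<nu> i = as ! i" "holds T \<nu> \<phi>"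
    by (auto simp: sat_iff)
  have "holds T (\<lambda>i. (as @ [\<nu> (length as)]) ! i) \<phi>"
    using \<nu>(3)
    by (rule iffD1[OF holds_cong, rotated]) (use assms(2) \<nu>(2) in \<open>auto simp: nth_append less_Suc_eq\<close>)
  then show "\<exists>x\<in>univ T. holds T (\<lambda>i. (as @ [x]) ! i) \<phi>"
    using \<nu>(1) by auto
next
  assume "\<exists>x\<in>univ T. holds T (\<lambda>i. (as @ [x]) ! i) \<phi>"
  then obtain x where x: "x \<in> univ T" "holds T (\<lambda>i. (as @ [x]) ! i) \<phi>"
    by auto
  \<comment> \<open>Position \<open>length as\<close> must carry \<open>x\<close>; later positions
    only have to carry some element of the universe.\<close>
  define \<nu> where "\<nu> i = (if i < length as then as ! i else x)" for i
  have "holds T \<nu> \<phi>"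
    using x(2)
    by (rule iffD1[OF holds_cong, rotated])
      (use assms(2) in \<open>auto simp: nth_append less_Suc_eq \<nu>_def\<close>)
  moreover have "range \<nu> \<subseteq> univ T"
    using assms(1) x(1) by (auto simp: \<nu>_def)
  moreover have "\<forall>i<length as. \<nu> i = as ! i"
    by (simp add: \<nu>_def)
  ultimately show "sat T as \<phi>"
    unfolding sat_iff by blast
qed

text \<open>With every free variable pinned, the oracle evaluates the formula; the nonempty universe
  supplies values for the remaining variables.\<close>

lemma sat_iff_holds:
  assumes "univ T \<noteq> {}" "set as \<subseteq> univ T" and "free_vars \<phi> \<subseteq> {..<length as}"
  shows "sat T as \<phi> \<longleftrightarrow> holds T (\<lambda>i. as ! i) \<phi>"
proof -
  have "holds T (\<lambda>i. (as @ [x]) ! i) \<phi> \<longleftrightarrow> holds T (\<lambda>i. as ! i) \<phi>" for x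
    by (rule holds_cong) (use assms(3) in \<open>auto simp: nth_append\<close>)
  moreover have "free_vars \<phi> \<subseteq> {..<Suc (length as)}"
    using assms(3) by (auto intro: less_SucI)
  ultimately show ?thesis
    using assms by (auto simp: sat_iff_ex_holds)
qed

section \<open>Automorphisms and types of tuples\<close>

lemma automorphism_bij: "automorphism V T \<pi> \<Longrightarrow> bij_betw \<pi> (univ T) (univ T)"
  by (simp add: automorphism_def iso_betw_def)

lemma automorphism_in_univ: "automorphism V T \<pi> \<Longrightarrow> x \<in> univ T \<Longrightarrow> \<pi> x \<in> univ T"
  by (meson automorphism_bij bij_betwE)

lemma automorphism_fint:
  "automorphism V T \<pi> \<Longrightarrow> f \<in> funs V \<Longrightarrow> length xs = far V f \<Longrightarrow> set xs \<subseteq> univ T \<Longrightarrow>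
    \<pi> (fint T f xs) = fint T f (map \<pi> xs)"
  by (simp add: automorphism_def iso_betw_def)

lemma automorphism_rint:
  "automorphism V T \<pi> \<Longrightarrow> r \<in> rels V \<Longrightarrow> length xs = rar V r \<Longrightarrow> set xs \<subseteq> univ T \<Longrightarrow>
    rint T r xs \<longleftrightarrow> rint T r (map \<pi> xs)"
  by (simp add: automorphism_def iso_betw_def)

lemma fint_in_univ:
  "is_struct V T \<Longrightarrow> f \<in> funs V \<Longrightarrow> length xs = far V f \<Longrightarrow> set xs \<subseteq> univ T \<Longrightarrow> fint T f xs \<in> univ T"
  by (simp add: is_struct_def tuples_def)

lemma automorphism_comp:
  assumes "automorphism V T \<pi>" "automorphism V T \<rho>"
  shows "automorphism V T (\<rho> \<circ> \<pi>)"
  unfolding automorphism_def iso_betw_def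
proof (intro conjI ballI allI impI; (elim conjE)?)
  show "bij_betw (\<rho> \<circ> \<pi>) (univ T) (univ T)"
    by (rule bij_betw_trans) (rule automorphism_bij assms)+
  have sub: "set (map \<pi> xs) \<subseteq> univ T" if "set xs \<subseteq> univ T" for xs
    using that automorphism_in_univ[OF assms(1)] by auto
  show "(\<rho> \<circ> \<pi>) (fint T f xs) = fint T f (map (\<rho> \<circ> \<pi>) xs)"
    if "f \<in> funs V" "length xs = far V f" "set xs \<subseteq> univ T" for f xs
    using that automorphism_fint[OF assms(1) that]
      automorphism_fint[OF assms(2) that(1) _ sub[OF that(3)]] by simp
  show "rint T r xs \<longleftrightarrow> rint T r (map (\<rho> \<circ> \<pi>) xs)"
    if "r \<in> rels V" "length xs = rar V r" "set xs \<subseteq> univ T" for r xs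
    using that automorphism_rint[OF assms(1) that]
      automorphism_rint[OF assms(2) that(1) _ sub[OF that(3)]] by simp
qed

lemma automorphism_inv:
  assumes T: "is_struct V T" and \<pi>: "automorphism V T \<pi>"
  obtains \<rho> where "automorphism V T \<rho>" "\<And>x. x \<in> univ T \<Longrightarrow> \<rho> (\<pi> x) = x"
    "\<And>x. x \<in> univ T \<Longrightarrow> \<pi> (\<rho> x) = x"
proof
  let ?\<rho> = "inv_into (univ T) \<pi>"
  note bij = automorphism_bij[OF \<pi>]
  show 1: "?\<rho> (\<pi> x) = x" if "x \<in> univ T" for x
    using bij that by (meson bij_betw_inv_into_left)
  show 2: "\<pi> (?\<rho> x) = x" if "x \<in> univ T" for x
    using bij that by (meson bij_betw_inv_into_right)
  have \<rho>: "bij_betw ?\<rho> (univ T) (univ T)"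
    by (rule bij_betw_inv_into[OF bij])
  have sub: "set (map ?\<rho> xs) \<subseteq> univ T" and cancel: "map \<pi> (map ?\<rho> xs) = xs"
    if "set xs \<subseteq> univ T" for xs
    using that \<rho> by (auto simp: bij_betw_def, auto intro!: map_idI 2)
  show "automorphism V T ?\<rho>"
    unfolding automorphism_def iso_betw_def
  proof (intro conjI ballI allI impI \<rho>; elim conjE)
    fix f xs assume f: "f \<in> funs V" and len: "length xs = far V f" and xs: "set xs \<subseteq> univ T"
    have "?\<rho> (fint T f (map \<pi> (map ?\<rho> xs))) = ?\<rho> (\<pi> (fint T f (map ?\<rho> xs)))"
      using automorphism_fint[OF \<pi> f _ sub[OF xs]] len by simp
    also have "\<dots> = fint T f (map ?\<rho> xs)"
      by (rule 1) (use fint_in_univ[OF T f _ sub[OF xs]] len in simp)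
    finally show "?\<rho> (fint T f xs) = fint T f (map ?\<rho> xs)"
      unfolding cancel[OF xs] .
  next
    fix r xs assume r: "r \<in> rels V" and len: "length xs = rar V r" and xs: "set xs \<subseteq> univ T"
    show "rint T r xs \<longleftrightarrow> rint T r (map ?\<rho> xs)"
      using automorphism_rint[OF \<pi> r _ sub[OF xs]] len unfolding cancel[OF xs] by simp
  qed
qed

lemma gen_subset_univ:
  assumes "is_struct V T" "S \<subseteq> univ T" shows "gen V T S \<subseteq> univ T"
proof
  fix x assume "x \<in> gen V T S"
  then show "x \<in> univ T"
    by induction (use assms in \<open>auto intro: fint_in_univ\<close>)
qed

lemma automorphism_image_gen:
  assumes T: "is_struct V T" and \<pi>: "automorphism V T \<pi>" and S: "S \<subseteq> univ T"
  shows "\<pi> ` gen V T S = gen V T (\<pi> ` S)"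
proof
  show "\<pi> ` gen V T S \<subseteq> gen V T (\<pi> ` S)"
  proof safe
    fix x assume "x \<in> gen V T S"
    then show "\<pi> x \<in> gen V T (\<pi> ` S)"
    proof induction
      case (base x)
      then show ?case by (auto intro: gen.base)
    next
      case (app f xs)
      have "set xs \<subseteq> univ T"
        using app.IH gen_subset_univ[OF T S] by auto
      then have "\<pi> (fint T f xs) = fint T f (map \<pi> xs)"
        using app.hyps by (intro automorphism_fint[OF \<pi>])
      moreover have "fint T f (map \<pi> xs) \<in> gen V T (\<pi> ` S)"
        using app by (intro gen.app) auto
      ultimately show ?case by simp
    qed
  qed
  show "gen V T (\<pi> ` S) \<subseteq> \<pi> ` gen V T S"
  proof
    fix y assume "y \<in> gen V T (\<pi> ` S)"
    then show "y \<in> \<pi> ` gen V T S"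
    proof induction
      case (base x)
      then show ?case by (auto intro: gen.base)
    next
      case (app f ys)
      have "ys \<in> lists (\<pi> ` gen V T S)"
        using app.IH by auto
      then obtain xs where xs: "ys = map \<pi> xs" "set xs \<subseteq> gen V T S"
        unfolding lists_image by auto
      then have "set xs \<subseteq> univ T"
        using gen_subset_univ[OF T S] by auto
      then have "\<pi> (fint T f xs) = fint T f ys"
        unfolding xs using app.hyps xs(1) by (intro automorphism_fint[OF \<pi>]) auto
      moreover have "fint T f xs \<in> gen V T S"
        using app.hyps xs by (intro gen.app) auto
      ultimately show ?case by (metis imageI)
    qed
  qed
qed

text \<open>Homogeneity extends an isomorphism of generated substructures to an automorphism.
  Conversely an automorphism carries generated substructures onto generated ones, so its restriction
  is such an isomorphism. Types of tuples are thus orbits.\<close>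

lemma simeq_iff:
  assumes T: "is_struct V T" and hom: "homogeneous V T"
  shows "(xs, ys) \<in> simeq V T d \<longleftrightarrow>
    xs \<in> tuples T d \<and> (\<exists>\<pi>. automorphism V T \<pi> \<and> map \<pi> xs = ys)"
proof
  assume "(xs, ys) \<in> simeq V T d"
  then obtain \<beta> where xs: "xs \<in> tuples T d" and ys: "ys \<in> tuples T d"
    and \<beta>: "iso_betw V T \<beta> (gen V T (set xs)) (gen V T (set ys))" and eq: "map \<beta> xs = ys"
    by (auto simp: simeq_def)
  have "finite (set xs)" "set xs \<subseteq> univ T" "finite (set ys)" "set ys \<subseteq> univ T"
    using xs ys by (auto simp: tuples_def)
  then obtain \<pi> where "automorphism V T \<pi>" "\<forall>x\<in>gen V T (set xs). \<pi> x = \<beta> x"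
    using hom \<beta> unfolding homogeneous_def by blast
  moreover from this have "map \<pi> xs = map \<beta> xs"
    by (auto intro: gen.base)
  ultimately show "xs \<in> tuples T d \<and> (\<exists>\<pi>. automorphism V T \<pi> \<and> map \<pi> xs = ys)"
    using xs eq by auto
next
  assume "xs \<in> tuples T d \<and> (\<exists>\<pi>. automorphism V T \<pi> \<and> map \<pi> xs = ys)"
  then obtain \<pi> where xs: "xs \<in> tuples T d" and \<pi>: "automorphism V T \<pi>" and ys: "ys = map \<pi> xs"
    by auto
  have sub: "gen V T (set xs) \<subseteq> univ T"
    by (rule gen_subset_univ[OF T]) (use xs in \<open>simp add: tuples_def\<close>)
  have "\<pi> ` gen V T (set xs) = gen V T (set ys)"
    using automorphism_image_gen[OF T \<pi>, of "set xs"] xs by (simp add: tuples_def ys)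
  then have "bij_betw \<pi> (gen V T (set xs)) (gen V T (set ys))"
    using automorphism_bij[OF \<pi>] sub by (auto simp: bij_betw_def intro: inj_on_subset)
  then have "iso_betw V T \<pi> (gen V T (set xs)) (gen V T (set ys))"
    unfolding iso_betw_def using automorphism_fint[OF \<pi>] automorphism_rint[OF \<pi>] sub by blast
  moreover have "ys \<in> tuples T d"
    using xs automorphism_in_univ[OF \<pi>] by (auto simp: tuples_def ys)
  ultimately show "(xs, ys) \<in> simeq V T d"
    using xs ys by (auto simp: simeq_def)
qed

lemma automorphism_id: "automorphism V T (\<lambda>x. x)"
  by (simp add: automorphism_def iso_betw_def bij_betw_def)

text \<open>The listed formulas define exactly the classes. Reflexivity puts \<open>xs\<close> into
  its own class, which gives the formula. Conversely, two tuples in the class of \<open>z\<close>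
  are images of \<open>z\<close>, and going back from \<open>xs\<close> to \<open>z\<close> and on
  to \<open>ys\<close> is an automorphism.\<close>

lemma simeq_iff_common_formula:
  assumes T: "is_struct V T" and hom: "homogeneous V T" and def: "defines_classes V T d \<phi>s"
    and xs: "xs \<in> tuples T d" and ys: "ys \<in> tuples T d"
  shows "(xs, ys) \<in> simeq V T d \<longleftrightarrow>
    (\<exists>\<phi>\<in>set \<phi>s. holds T (\<lambda>i. xs ! i) \<phi> \<and> holds T (\<lambda>i. ys ! i) \<phi>)"
proof
  assume "(xs, ys) \<in> simeq V T d"
  moreover have "(xs, xs) \<in> simeq V T d"
    unfolding simeq_iff[OF T hom] using xs automorphism_id[of V T] by auto
  moreover have "simeq V T d `` {xs} \<in> tuples T d // simeq V T d"
    by (rule quotientI[OF xs])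
  then obtain \<phi> where "\<phi> \<in> set \<phi>s"
    "simeq V T d `` {xs} = {xs \<in> tuples T d. holds T (\<lambda>i. xs ! i) \<phi>}"
    using def unfolding defines_classes_def by (metis (no_types, lifting) imageE)
  ultimately show "\<exists>\<phi>\<in>set \<phi>s. holds T (\<lambda>i. xs ! i) \<phi> \<and> holds T (\<lambda>i. ys ! i) \<phi>"
    by blast
next
  assume "\<exists>\<phi>\<in>set \<phi>s. holds T (\<lambda>i. xs ! i) \<phi> \<and> holds T (\<lambda>i. ys ! i) \<phi>"
  then obtain \<phi> where \<phi>: "\<phi> \<in> set \<phi>s" "holds T (\<lambda>i. xs ! i) \<phi>" "holds T (\<lambda>i. ys ! i) \<phi>"
    by auto
  let ?C = "{xs \<in> tuples T d. holds T (\<lambda>i. xs ! i) \<phi>}"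
  have "?C \<in> tuples T d // simeq V T d"
    using def \<phi>(1) unfolding defines_classes_def by blast
  then obtain z where z: "z \<in> tuples T d" "?C = simeq V T d `` {z}"
    by (auto elim: quotientE)
  have "(z, xs) \<in> simeq V T d" "(z, ys) \<in> simeq V T d"
    using \<phi> xs ys z(2) by blast+
  then obtain \<pi> \<rho> where \<pi>: "automorphism V T \<pi>" "map \<pi> z = xs"
    and \<rho>: "automorphism V T \<rho>" "map \<rho> z = ys"
    unfolding simeq_iff[OF T hom] by auto
  obtain \<pi>' where \<pi>': "automorphism V T \<pi>'" "\<And>x. x \<in> univ T \<Longrightarrow> \<pi>' (\<pi> x) = x"
    using automorphism_inv[OF T \<pi>(1)] by metis
  have "map \<pi>' xs = z"
    unfolding \<pi>(2)[symmetric] using z(1) \<pi>'(2) by (auto simp: tuples_def intro!: map_idI)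
  then have "map (\<rho> \<circ> \<pi>') xs = ys"
    using \<rho>(2) by (simp flip: map_map)
  then show "(xs, ys) \<in> simeq V T d"
    unfolding simeq_iff[OF T hom] using xs automorphism_comp[OF \<pi>'(1) \<rho>(1)] by blast
qed

text \<open>The given algorithm starts at length 1, while a configuration with only nullary
  predicates has an empty argument list. There is a single empty tuple, hence a single
  class.\<close>

lemma defines_classes_0: "defines_classes V T 0 [Tru]"
proof -
  have "iso_betw V T (\<lambda>x. x) (gen V T {}) (gen V T {})"
    by (simp add: iso_betw_def bij_betw_def)
  then have "simeq V T 0 = {([], [])}"
    by (auto simp: simeq_def tuples_def)
  then show ?thesis
    by (auto simp: defines_classes_def tuples_def quotient_def qf_formulas_def free_vars_def)
qed

section \<open>Cubes\<close>

text \<open>A computable form of \<open>dnf\<close> for positive formulas: lists replace sets, and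
  signs are dropped because all literals are positive. On other formulas a negative literal would be
  listed without its sign. Conjunction goes through \<open>product_lists\<close>, which is already
  known to be computable.\<close>

primrec cubes :: "bool \<Rightarrow> 'p form \<Rightarrow> 'p list list" where
  "cubes b Tru = (if b then [[]] else [])"
| "cubes b Fls = (if b then [] else [[]])"
| "cubes b (Atom p) = [[p]]"
| "cubes b (Neg \<phi>) = cubes (\<not> b) \<phi>"
| "cubes b (Conj \<phi> \<psi>) =
     (if b then map concat (product_lists [cubes b \<phi>, cubes b \<psi>]) else cubes b \<phi> @ cubes b \<psi>)"
| "cubes b (Disj \<phi> \<psi>) =
     (if b then cubes b \<phi> @ cubes b \<psi> else map concat (product_lists [cubes b \<phi>, cubes b \<psi>]))"

lemma set_map_concat_product_lists2:
  "set (map concat (product_lists [xs, ys])) = {x @ y |x y. x \<in> set xs \<and> y \<in> set ys}"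
proof -
  have "map concat (product_lists [xs, ys]) = concat (map (\<lambda>x. map (\<lambda>y. x @ y) ys) xs)"
    by (simp add: map_concat comp_def concat_map_singleton)
  then show ?thesis
    by (auto simp: image_iff)
qed

lemma image_set_append:
  "(\<lambda>c. h ` set c) ` {x @ y |x y. x \<in> X \<and> y \<in> Y} =
    {c \<union> d |c d. c \<in> (\<lambda>c. h ` set c) ` X \<and> d \<in> (\<lambda>c. h ` set c) ` Y}" (is "?L = ?R")
proof
  show "?L \<subseteq> ?R"
    by (auto simp: image_Un) blast
  show "?R \<subseteq> ?L"
  proof
    fix e assume "e \<in> ?R"
    then obtain x y where "x \<in> X" "y \<in> Y" "e = h ` set (x @ y)"
      by (auto simp: image_Un)
    then show "e \<in> ?L" by blast
  qed
qed

text \<open>Passing a negation flips \<open>b\<close>, and the hypothesis flips along with it, so an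
  atom is reached only with \<open>b = True\<close>.\<close>

lemma dnf_eq_cubes:
  "occs (\<not> b) \<phi> = {} \<Longrightarrow> dnf b \<phi> = (\<lambda>c. (\<lambda>p. (p, True)) ` set c) ` set (cubes b \<phi>)"
proof (induction \<phi> arbitrary: b)
  case (Conj \<phi> \<psi>)
  then show ?case
    by (cases b) (simp_all only: dnf.simps cubes.simps set_map_concat_product_lists2
      image_set_append occs.simps Un_empty if_True if_False set_append image_Un)
next
  case (Disj \<phi> \<psi>)
  then show ?case
    by (cases b) (simp_all only: dnf.simps cubes.simps set_map_concat_product_lists2
      image_set_append occs.simps Un_empty if_True if_False set_append image_Un)
qed (auto split: if_splits)

text \<open>Cubes are assembled without ever comparing atoms, hence they commute with renaming. With
  \<open>map_state\<close> as the renaming, this moves transitions along an automorphism.\<close>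

lemma cubes_map_form: "cubes b (map_form g \<phi>) = map (map g) (cubes b \<phi>)"
  by (induction \<phi> arbitrary: b) (simp_all add: map_concat comp_def)

text \<open>A cube of the conjunction takes one cube from each conjunct. Distinctness turns this
  choice by position into a choice function on elements, which can be updated at the head without
  disturbing the tail.\<close>

lemma dnf_foldr_Conj:
  assumes "distinct ts"
  shows "dnf True (foldr Conj (map f ts) Tru) =
    {(\<Union>t\<in>set ts. c t) |c. \<forall>t\<in>set ts. c t \<in> dnf True (f t)}"
  using assms
proof (induction ts)
  case Nil
  then show ?case by simp
next
  case (Cons u ts)
  show ?case (is "?L = ?R")
  proof
    show "?R \<subseteq> ?L"
      using Cons by auto
    show "?L \<subseteq> ?R"
    proof
      fix e assume "e \<in> ?L"
      then obtain d c where d: "d \<in> dnf True (f u)" and c: "\<forall>t\<in>set ts. c t \<in> dnf True (f t)"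
        and e: "e = d \<union> (\<Union>t\<in>set ts. c t)"
        using Cons by auto
      have "u \<notin> set ts"
        using Cons.prems by simp
      then have "e = (\<Union>t\<in>set (u # ts). (c(u := d)) t)" "\<forall>t\<in>set (u # ts). (c(u := d)) t \<in> dnf True (f t)"
        using d c by (auto simp: e split: if_splits)
      then show "e \<in> ?R" by blast
    qed
  qed
qed

text \<open>Atoms of \<open>V\<close> become truth constants under instantiation, so only predicate
  atoms survive, with unchanged polarity.\<close>

lemma occs_inst:
  "(\<forall>q ts. Rel (Inr q) ts \<notin> occs b \<phi>) \<Longrightarrow> occs b (inst T \<nu> \<phi>) = {}"
proof (induction \<phi> arbitrary: b)
  case (Atom p)
  then show ?case
    by (cases "(T, \<nu>, p)" rule: inst_atom.cases) (auto split: if_splits)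
qed auto

lemma dnf_delta_hat:
  assumes "predicate_automaton V Q A" "t \<in> states T Q" "\<sigma> \<in> alphabet A"
  shows "dnf True (delta_hat T A t \<sigma> a) =
    (\<lambda>c. (\<lambda>p. (p, True)) ` set c) ` set (cubes True (delta_hat T A t \<sigma> a))"
  using assms
  by (intro dnf_eq_cubes)
    (auto simp: delta_hat_def predicate_automaton_def pos_formulas_def states_def intro!: occs_inst)

text \<open>Removes the order of the conjuncts and the signs from the definition: a transition
  chooses a cube for each state independently and takes the union.\<close>

lemma step_iff:
  assumes A: "predicate_automaton V Q A" and C: "C \<in> configs T Q" and \<sigma>: "\<sigma> \<in> alphabet A"
  shows "step T A C \<sigma> (a :: 'd) (C' :: ('c, 'd) state set) \<longleftrightarrow>
    (\<exists>c. (\<forall>t\<in>C. c t \<in> set (cubes True (delta_hat T A t \<sigma> a))) \<and> C' = (\<Union>t\<in>C. set (c t)))"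
proof -
  let ?l = "\<lambda>t :: ('c, 'd) state. (t, True)"
  have inj: "inj ?l"
    by (rule injI) simp
  have fin: "finite C" and sub: "C \<subseteq> states T Q"
    using C by (auto simp: configs_def)
  have "step T A C \<sigma> a C' \<longleftrightarrow>
      (\<exists>c. (\<forall>t\<in>C. c t \<in> dnf True (delta_hat T A t \<sigma> a)) \<and> ?l ` C' = (\<Union>t\<in>C. c t))"
    (is "_ \<longleftrightarrow> ?P")
  proof
    assume "step T A C \<sigma> a C'"
    then obtain ts where "distinct ts" "set ts = C"
      "?l ` C' \<in> dnf True (foldr Conj (map (\<lambda>t. delta_hat T A t \<sigma> a) ts) Tru)"
      unfolding step_def by blast
    then show ?P
      by (auto simp: dnf_foldr_Conj)
  next
    assume ?P
    moreover obtain ts where "distinct ts" "set ts = C"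
      using finite_distinct_list[OF fin] by blast
    ultimately show "step T A C \<sigma> a C'"
      unfolding step_def by (intro exI[of _ ts]) (auto simp: dnf_foldr_Conj)
  qed
  also have "\<dots> \<longleftrightarrow> (\<exists>c. (\<forall>t\<in>C. c t \<in> set (cubes True (delta_hat T A t \<sigma> a))) \<and>
      ?l ` C' = (\<Union>t\<in>C. ?l ` set (c t)))" (is "?P \<longleftrightarrow> ?Q")
  proof
    assume ?P
    then obtain c where c: "\<forall>t\<in>C. c t \<in> dnf True (delta_hat T A t \<sigma> a)" "?l ` C' = (\<Union>t\<in>C. c t)"
      by blast
    have "\<forall>t\<in>C. \<exists>d\<in>set (cubes True (delta_hat T A t \<sigma> a)). c t = ?l ` set d"
    proof
      fix t assume t: "t \<in> C"
      then have "c t \<in> dnf True (delta_hat T A t \<sigma> a)" "t \<in> states T Q"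
        using c(1) sub by blast+
      then have "c t \<in> (\<lambda>c. ?l ` set c) ` set (cubes True (delta_hat T A t \<sigma> a))"
        using dnf_delta_hat[OF A _ \<sigma>] by metis
      then show "\<exists>d\<in>set (cubes True (delta_hat T A t \<sigma> a)). c t = ?l ` set d"
        by blast
    qed
    then obtain d where "\<forall>t\<in>C. d t \<in> set (cubes True (delta_hat T A t \<sigma> a)) \<and> c t = ?l ` set (d t)"
      by metis
    with c(2) show ?Q
      by (intro exI[of _ d]) auto
  next
    assume ?Q
    then obtain c where c: "\<forall>t\<in>C. c t \<in> set (cubes True (delta_hat T A t \<sigma> a))"
      "?l ` C' = (\<Union>t\<in>C. ?l ` set (c t))"
      by blast
    then show ?P
      using sub by (intro exI[of _ "\<lambda>t. ?l ` set (c t)"]) (auto simp: dnf_delta_hat[OF A _ \<sigma>] subset_iff)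
  qed
  finally show ?thesis
    unfolding image_UN[symmetric] inj_image_eq_iff[OF inj] .
qed

section \<open>Equivariance of the transition relation\<close>

definition map_state :: "('a \<Rightarrow> 'a) \<Rightarrow> ('q, 'a) state \<Rightarrow> ('q, 'a) state" where
  "map_state \<pi> t = (fst t, map \<pi> (snd t))"

lemma covering_le_iff:
  "covering_le V T C C' \<longleftrightarrow> (\<exists>\<pi>. automorphism V T \<pi> \<and> map_state \<pi> ` C \<subseteq> C')"
  by (auto simp: covering_le_def map_state_def) fastforce+

lemma eval_tm_in_univ:
  assumes "is_struct V T" "wf_tm V t" "\<And>i. i \<in> tm_vars t \<Longrightarrow> \<nu> i \<in> univ T"
  shows "eval_tm T \<nu> t \<in> univ T"
  using assms(2,3)
proof (induction t)
  case (Fun f ts)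
  have "eval_tm T \<nu> t \<in> univ T" if "t \<in> set ts" for t
    using Fun that by (intro Fun.IH) (auto simp: list_all_iff)
  then show ?case
    using Fun.prems by (auto intro!: fint_in_univ[OF assms(1)])
qed simp

lemma eval_tm_automorphism:
  assumes "is_struct V T" "automorphism V T \<pi>" "wf_tm V t" "\<And>i. i \<in> tm_vars t \<Longrightarrow> \<nu> i \<in> univ T"
  shows "eval_tm T (\<lambda>i. \<pi> (\<nu> i)) t = \<pi> (eval_tm T \<nu> t)"
  using assms(3,4)
proof (induction t)
  case (Fun f ts)
  have "map (eval_tm T (\<lambda>i. \<pi> (\<nu> i))) ts = map \<pi> (map (eval_tm T \<nu>) ts)"
    using Fun unfolding map_map by (intro map_cong refl) (auto simp: list_all_iff)
  moreover have "\<pi> (fint T f (map (eval_tm T \<nu>) ts)) = fint T f (map \<pi> (map (eval_tm T \<nu>) ts))"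
    using Fun.prems
    by (intro automorphism_fint[OF assms(2)])
      (auto simp: list_all_iff intro!: eval_tm_in_univ[OF assms(1)])
  ultimately show ?case
    by (simp only: eval_tm.simps)
qed simp

lemma wf_tm_join [simp]: "wf_tm (join_vocab V Q) t \<longleftrightarrow> wf_tm V t"
  by (induction t) (auto simp: join_vocab_def list_all_iff)

lemma inst_cong:
  assumes "\<And>i. i \<in> free_vars \<phi> \<Longrightarrow> \<nu> i = \<mu> i"
  shows "inst T \<nu> \<phi> = inst T \<mu> \<phi>"
  using assms
proof (induction \<phi>)
  case (Atom p)
  show ?case
  proof (cases p)
    case (Eq s t)
    have "eval_tm T \<nu> s = eval_tm T \<mu> s" "eval_tm T \<nu> t = eval_tm T \<mu> t"
      by (auto intro!: eval_tm_cong Atom simp: free_vars_def Eq)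
    then show ?thesis by (simp add: Eq)
  next
    case (Rel r ts)
    have eq: "map (eval_tm T \<nu>) ts = map (eval_tm T \<mu>) ts"
      by (auto intro!: eval_tm_cong Atom simp: free_vars_def Rel)
    show ?thesis
      by (cases r) (simp_all only: Rel inst.simps inst_atom.simps eq)
  qed
qed (auto simp: free_vars_def)

text \<open>Equations keep their truth value since \<open>\<pi>\<close> is injective, atoms of
  \<open>V\<close> since it preserves the relations, and predicate atoms move along with their
  arguments.\<close>

lemma inst_automorphism:
  assumes T: "is_struct V T" and \<pi>: "automorphism V T \<pi>"
    and "\<phi> \<in> qf_formulas (join_vocab V Q)" "\<And>i. i \<in> free_vars \<phi> \<Longrightarrow> \<nu> i \<in> univ T"
  shows "inst T (\<lambda>i. \<pi> (\<nu> i)) \<phi> = map_form (map_state \<pi>) (inst T \<nu> \<phi>)"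
  using assms(3,4)
proof (induction \<phi>)
  case (Atom p)
  have wf: "wf_atom (join_vocab V Q) p" and fv: "\<And>i. i \<in> atom_vars p \<Longrightarrow> \<nu> i \<in> univ T"
    using Atom by (auto simp: qf_formulas_def free_vars_def)
  show ?case
  proof (cases p)
    case (Eq s t)
    have st: "wf_tm V s" "wf_tm V t" "\<And>i. i \<in> tm_vars s \<Longrightarrow> \<nu> i \<in> univ T"
      "\<And>i. i \<in> tm_vars t \<Longrightarrow> \<nu> i \<in> univ T"
      using wf fv by (auto simp: Eq)
    have "\<pi> (eval_tm T \<nu> s) = \<pi> (eval_tm T \<nu> t) \<longleftrightarrow> eval_tm T \<nu> s = eval_tm T \<nu> t"
      using automorphism_bij[OF \<pi>] eval_tm_in_univ[OF T st(1,3)] eval_tm_in_univ[OF T st(2,4)]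
      by (auto simp: bij_betw_def dest: inj_onD)
    then show ?thesis
      by (simp add: Eq eval_tm_automorphism[OF T \<pi> st(1,3)] eval_tm_automorphism[OF T \<pi> st(2,4)])
  next
    case (Rel r ts)
    have ts: "wf_tm V t \<and> (\<forall>i\<in>tm_vars t. \<nu> i \<in> univ T)" if "t \<in> set ts" for t
      using wf fv that by (auto simp: Rel)
    have eq: "map (eval_tm T (\<lambda>i. \<pi> (\<nu> i))) ts = map \<pi> (map (eval_tm T \<nu>) ts)"
      using ts by (auto intro!: eval_tm_automorphism[OF T \<pi>])
    show ?thesis
    proof (cases r)
      case (Inl r')
      have "rint T r' (map (eval_tm T \<nu>) ts) \<longleftrightarrow> rint T r' (map \<pi> (map (eval_tm T \<nu>) ts))"
        using wf ts
        by (intro automorphism_rint[OF \<pi>])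
          (auto simp: Rel Inl join_vocab_def intro!: eval_tm_in_univ[OF T])
      then show ?thesis
        unfolding Rel Inl inst.simps inst_atom.simps eq by simp
    next
      case (Inr q)
      show ?thesis
        unfolding Rel Inr inst.simps inst_atom.simps eq by (simp add: map_state_def)
    qed
  qed
qed (auto simp: qf_formulas_def free_vars_def)

lemma delta_hat_automorphism:
  assumes T: "is_struct V T" and \<pi>: "automorphism V T \<pi>" and A: "predicate_automaton V Q A"
    and t: "t \<in> states T Q" and \<sigma>: "\<sigma> \<in> alphabet A" and a: "a \<in> univ T"
  shows "delta_hat T A (map_state \<pi> t) \<sigma> (\<pi> a) = map_form (map_state \<pi>) (delta_hat T A t \<sigma> a)"
proof -
  obtain q as where t_eq: "t = (q, as)" by (cases t)
  have q: "q \<in> rels Q" and as: "length as = rar Q q" "set as \<subseteq> univ T"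
    using t by (auto simp: states_def tuples_def t_eq)
  have \<delta>: "delta A q \<sigma> \<in> qf_formulas (join_vocab V Q)" "free_vars (delta A q \<sigma>) \<subseteq> {..rar Q q}"
    using A q \<sigma> by (auto simp: predicate_automaton_def pos_formulas_def)
  have "inst T (\<lambda>j. \<pi> ((a # as) ! j)) (delta A q \<sigma>) =
      map_form (map_state \<pi>) (inst T (\<lambda>j. (a # as) ! j) (delta A q \<sigma>))"
  proof (rule inst_automorphism[OF T \<pi> \<delta>(1)])
    fix i assume "i \<in> free_vars (delta A q \<sigma>)"
    then have "i < length (a # as)"
      using \<delta>(2) as by auto
    then have "(a # as) ! i \<in> set (a # as)" by (rule nth_mem)
    then show "(a # as) ! i \<in> univ T" using a as by auto
  qed
  \<comment> \<open>Beyond the end of a list, \<open>!\<close> need not commute with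
    \<open>\<pi>\<close>; the valuations are compared only at the free variables, all of which are
    at most \<open>rar Q q\<close>.\<close>
  moreover have "inst T (\<lambda>j. (\<pi> a # map \<pi> as) ! j) (delta A q \<sigma>) = inst T (\<lambda>j. \<pi> ((a # as) ! j)) (delta A q \<sigma>)"
    by (rule inst_cong) (use \<delta>(2) as in \<open>auto simp: nth_Cons split: nat.splits\<close>)
  ultimately show ?thesis
    by (simp add: delta_hat_def t_eq map_state_def)
qed

text \<open>Every state of \<open>D\<close> pulls back the cube chosen for its image in
  \<open>C\<close>; states of \<open>C\<close> outside the image are ignored. This simulation is
  used twice: for a configuration below another in the covering pre-order, and for
  \<open>D = C\<close> with an automorphism that fixes all arguments and only replaces the
  letter.\<close>

lemma step_automorphism_subset:
  assumes T: "is_struct V T" and \<pi>: "automorphism V T \<pi>" and A: "predicate_automaton V Q A"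
    and C: "C \<in> configs T Q" and D: "D \<in> configs T Q" and DC: "map_state \<pi> ` D \<subseteq> C"
    and \<sigma>: "\<sigma> \<in> alphabet A" and a: "a \<in> univ T" and step: "step T A C \<sigma> (\<pi> a) C'"
  obtains D' where "step T A D \<sigma> a D'" "map_state \<pi> ` D' \<subseteq> C'"
proof -
  obtain c where c: "\<And>t. t \<in> C \<Longrightarrow> c t \<in> set (cubes True (delta_hat T A t \<sigma> (\<pi> a)))"
    and C': "C' = (\<Union>t\<in>C. set (c t))"
    using step unfolding step_iff[OF A C \<sigma>] by blast
  have "\<exists>d. d \<in> set (cubes True (delta_hat T A t \<sigma> a)) \<and> c (map_state \<pi> t) = map (map_state \<pi>) d"
    if "t \<in> D" for t
  proof -
    have "t \<in> states T Q"
      using that D by (auto simp: configs_def)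
    moreover have "map_state \<pi> t \<in> C"
      using that DC by auto
    ultimately show ?thesis
      using c[of "map_state \<pi> t"]
      by (auto simp: delta_hat_automorphism[OF T \<pi> A _ \<sigma> a] cubes_map_form)
  qed
  then obtain d where d: "\<And>t. t \<in> D \<Longrightarrow> d t \<in> set (cubes True (delta_hat T A t \<sigma> a))"
    "\<And>t. t \<in> D \<Longrightarrow> c (map_state \<pi> t) = map (map_state \<pi>) (d t)"
    by metis
  show thesis
  proof (rule that)
    show "step T A D \<sigma> a (\<Union>t\<in>D. set (d t))"
      unfolding step_iff[OF A D \<sigma>] using d(1) by blast
    show "map_state \<pi> ` (\<Union>t\<in>D. set (d t)) \<subseteq> C'"
    proof (rule image_subsetI)
      fix s assume "s \<in> (\<Union>t\<in>D. set (d t))"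
      then obtain t where t: "t \<in> D" and s: "s \<in> set (d t)"
        by blast
      have "map_state \<pi> s \<in> set (c (map_state \<pi> t))"
        using s by (simp add: d(2)[OF t])
      then show "map_state \<pi> s \<in> C'"
        using t DC by (auto simp: C')
    qed
  qed
qed

section \<open>Computing with configurations\<close>

text \<open>The list is fixed in advance, so each entry may have its own program. It serves for the
  arguments of a symbol in a fixed formula and for the letters of the alphabet.\<close>

lemma computable_on_map_fixed:
  assumes "\<And>y. y \<in> set ys \<Longrightarrow> computable_on D c d (f y)"
  shows "computable_on D c (list_code d) (\<lambda>x. map (\<lambda>y. f y x) ys)"
  using assms by (induction ys) (auto intro: computable_on_Cons)

text \<open>The product chooses by position; as \<open>ts\<close> has no repetitions,
  \<open>map_of\<close> reads the choice as a function of the elements.\<close>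

lemma in_product_lists_map:
  assumes "distinct ts" "xs \<in> set (product_lists (map f ts))"
  shows "\<exists>c. xs = map c ts \<and> (\<forall>t\<in>set ts. c t \<in> set (f t))"
proof -
  have "list_all2 (\<lambda>x t. x \<in> set (f t)) xs ts"
    using assms(2) by (simp add: product_lists_set list_all2_map2)
  then have len: "length xs = length ts" and nth: "\<And>i. i < length ts \<Longrightarrow> xs ! i \<in> set (f (ts ! i))"
    by (simp_all add: list_all2_conv_all_nth)
  define c where "c t = the (map_of (zip ts xs) t)" for t
  have c: "c (ts ! i) = xs ! i" if "i < length ts" for i
    using that len assms(1) by (simp add: c_def map_of_zip_nth)
  then have "xs = map c ts"
    using len by (simp add: list_eq_iff_nth_eq)
  moreover have "\<forall>t\<in>set ts. c t \<in> set (f t)"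
    using c nth by (auto simp: in_set_conv_nth)
  ultimately show ?thesis by blast
qed

lemma map_in_product_lists:
  "(\<And>t. t \<in> set ts \<Longrightarrow> c t \<in> set (f t)) \<Longrightarrow> map c ts \<in> set (product_lists (map f ts))"
  by (auto simp: product_lists_set list_all2_conv_all_nth)

text \<open>One tuple for the whole configuration: its type also records how the arguments of
  different states are related, which separate types of the states would lose.\<close>

definition args :: "('q, 'a) state list \<Rightarrow> 'a list" where
  "args ts = concat (map snd ts)"

lemma computable_on_args:
  "computable_on D c (list_code (app_code cq ca)) f \<Longrightarrow>
    computable_on D c (list_code ca) (\<lambda>x. args (f x))"
  unfolding args_def app_code_eq_pair_code
  by (rule computable_on_concat computable_on_map[where f="\<lambda>_. snd"] computable_on_snd[where f=snd]
      | assumption | rule computable_on_snd_arg)+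

lemma args_in_univ: "set ts \<subseteq> states T Q \<Longrightarrow> set (args ts) \<subseteq> univ T"
  by (fastforce simp: args_def states_def tuples_def)

lemma args_map_state: "args (map (map_state \<pi>) ts) = map \<pi> (args ts)"
  by (simp add: args_def map_concat comp_def map_state_def)

definition cube_lists :: "('f, 'r, 'a) struct \<Rightarrow> ('f, 'r, 'q, 's) pautomaton \<Rightarrow> 's \<Rightarrow>
    ('q, 'a) state list \<Rightarrow> 'a \<Rightarrow> ('q, 'a) state list list" where
  "cube_lists T A \<sigma> ts x =
     map concat (product_lists (map (\<lambda>t. cubes True (delta_hat T A t \<sigma> x)) ts))"

text \<open>Choice functions on the states correspond to entries of the product, so the successors
  under one letter form a list that can be computed.\<close>

lemma step_iff_cube_lists:
  assumes A: "predicate_automaton V Q A" and C: "C \<in> configs T Q" and \<sigma>: "\<sigma> \<in> alphabet A"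
    and ts: "distinct ts" "set ts = C"
  shows "step T A C \<sigma> x C' \<longleftrightarrow> C' \<in> set ` set (cube_lists T A \<sigma> ts x)"
  unfolding step_iff[OF A C \<sigma>]
proof
  assume "\<exists>c. (\<forall>t\<in>C. c t \<in> set (cubes True (delta_hat T A t \<sigma> x))) \<and> C' = (\<Union>t\<in>C. set (c t))"
  then obtain c where c: "\<And>t. t \<in> set ts \<Longrightarrow> c t \<in> set (cubes True (delta_hat T A t \<sigma> x))"
    and C': "C' = set (concat (map c ts))"
    using ts(2) by auto
  have "concat (map c ts) \<in> set (cube_lists T A \<sigma> ts x)"
    unfolding cube_lists_def set_map by (rule imageI) (rule map_in_product_lists[OF c])
  then show "C' \<in> set ` set (cube_lists T A \<sigma> ts x)"
    unfolding C' by (rule imageI)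
next
  assume "C' \<in> set ` set (cube_lists T A \<sigma> ts x)"
  then obtain xs where xs: "xs \<in> set (product_lists (map (\<lambda>t. cubes True (delta_hat T A t \<sigma> x)) ts))"
    and C': "C' = set (concat xs)"
    unfolding cube_lists_def by auto
  from in_product_lists_map[OF ts(1) xs] obtain c where "xs = map c ts"
    "\<forall>t\<in>set ts. c t \<in> set (cubes True (delta_hat T A t \<sigma> x))"
    by blast
  then show "\<exists>c. (\<forall>t\<in>C. c t \<in> set (cubes True (delta_hat T A t \<sigma> x))) \<and> C' = (\<Union>t\<in>C. set (c t))"
    using C' ts(2) by (intro exI[of _ c]) auto
qed

section \<open>Algorithms for a fixed automaton over an effectively presented structure\<close>

locale effective_automaton =
  fixes V :: "('f, 'r) vocab" and T :: "('f, 'r, 'a) struct"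
    and cf :: "'f \<Rightarrow> nat" and cr :: "'r \<Rightarrow> nat" and ca :: "'a \<Rightarrow> nat"
    and Q :: "('f, 'q) vocab" and cq :: "'q \<Rightarrow> nat"
    and A :: "('f, 'r, 'q, 's) pautomaton"
  assumes struct: "is_struct V T"
    and presentation: "effective_presentation V T cf cr ca"
    and homogeneous: "homogeneous V T"
    and classes_computable:
      "\<exists>\<Phi>. computable_on {d. d \<ge> 1} id (\<lambda>\<phi>s. list_encode (map (qf_code cf cr) \<phi>s)) \<Phi> \<and>
           (\<forall>d\<ge>1. defines_classes V T d (\<Phi> d))"
    and satisfiability_decidable:
      "decidable_on (qf_formulas (const_vocab V T)) (qf_code (const_code cf ca) cr)
         (satisfiable (const_struct T))"
    and finite_Q: "finite (rels Q)"
    and codes_Q: "inj_on cq (rels Q)"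
    and automaton: "predicate_automaton V Q A"
begin

abbreviation state_code :: "('q, 'a) state \<Rightarrow> nat" where
  "state_code \<equiv> app_code cq ca"

lemma inj_ca: "inj_on ca (univ T)"
  using presentation by (simp add: effective_presentation_def)

lemma inj_state_code: "inj_on state_code (states T Q)"
proof (rule inj_onI)
  fix s t assume s: "s \<in> states T Q" and t: "t \<in> states T Q" and eq: "state_code s = state_code t"
  have "map ca (snd s) = map ca (snd t)" "cq (fst s) = cq (fst t)"
    using eq by (auto simp: app_code_def case_prod_unfold list_encode_eq)
  moreover have "set (snd s) \<union> set (snd t) \<subseteq> univ T" "fst s \<in> rels Q" "fst t \<in> rels Q"
    using s t by (auto simp: states_def tuples_def)
  ultimately show "s = t"
    using inj_on_map_eq_map[OF inj_on_subset[OF inj_ca]] inj_onD[OF codes_Q]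
    by (metis prod_eqI)
qed

text \<open>Ordering the states by their codes makes the list of codes the sorted list of bit
  positions in the code of the configuration.\<close>

definition conf_list :: "('q, 'a) state set \<Rightarrow> ('q, 'a) state list" where
  "conf_list C = map (inv_into (states T Q) state_code) (sorted_list_of_set (state_code ` C))"

lemma
  assumes "C \<in> configs T Q"
  shows set_conf_list: "set (conf_list C) = C" and distinct_conf_list: "distinct (conf_list C)"
    and map_conf_list: "map state_code (conf_list C) = sorted_list_of_set (state_code ` C)"
proof -
  have C: "finite C" "C \<subseteq> states T Q"
    using assms by (auto simp: configs_def)
  show map: "map state_code (conf_list C) = sorted_list_of_set (state_code ` C)"
    unfolding conf_list_def map_map using C
    by (intro map_idI) (auto intro!: f_inv_into_f)
  from map have "distinct (map state_code (conf_list C))"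
    by simp
  then show "distinct (conf_list C)"
    by (simp add: distinct_map)
  have "inv_into (states T Q) state_code (state_code t) = t" if "t \<in> C" for t
    using that C(2) by (intro inv_into_f_f[OF inj_state_code]) auto
  then show "set (conf_list C) = C"
    using C by (simp add: conf_list_def image_image)
qed

lemma computable_on_conf_list:
  assumes "computable_on D c (config_code cq ca) f" "\<And>x. x \<in> D \<Longrightarrow> f x \<in> configs T Q"
  shows "computable_on D c (list_code state_code) (\<lambda>x. conf_list (f x))"
proof -
  have "computable_on D c set_encode (\<lambda>x. state_code ` f x)"
    by (rule computable_on_recode[OF assms(1)]) (simp add: config_code_def)
  then have "computable_on D c (list_code id) (\<lambda>x. sorted_list_of_set (state_code ` f x))"
    by (rule computable_on_comp[OF computable_on_sorted_list_of_set])
      (use assms(2) in \<open>auto simp: configs_def\<close>)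
  then show ?thesis
    by (rule computable_on_recode) (simp add: list_code_def map_conf_list[OF assms(2)])
qed

text \<open>The term is fixed, so the induction assembles a program for it, with one call of the
  interpretation at each function symbol; the code of the term never occurs. Fixing the length
  \<open>m\<close> keeps all variable lookups within the tuple.\<close>

lemma computable_on_eval_tm:
  assumes "wf_tm V t" "tm_vars t \<subseteq> {..<m}"
  shows "computable_on (tuples T m) (list_code ca) ca (\<lambda>xs. eval_tm T (\<lambda>i. xs ! i) t)"
  using assms
proof (induction t)
  case (Var i)
  then show ?case
    by (auto intro!: computable_on_nth computable_on_id computable_on_const simp: tuples_def)
next
  case (Fun f ts)
  have args: "computable_on (tuples T m) (list_code ca) (list_code ca)
      (\<lambda>xs. map (\<lambda>t. eval_tm T (\<lambda>i. xs ! i) t) ts)"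
    by (rule computable_on_map_fixed) (use Fun in \<open>auto simp: list_all_iff\<close>)
  have "computable_on (SIGMA f:funs V. tuples T (far V f)) (app_code cf ca) ca
      (\<lambda>(f, xs). fint T f xs)"
    using presentation by (simp add: effective_presentation_def)
  moreover have "computable_on (tuples T m) (list_code ca) (app_code cf ca)
      (\<lambda>xs. (f, map (\<lambda>t. eval_tm T (\<lambda>i. xs ! i) t) ts))"
    unfolding app_code_eq_pair_code
    by (intro computable_on_pair computable_on_const args)
  ultimately have "computable_on (tuples T m) (list_code ca) ca
      (\<lambda>xs. (\<lambda>(f, xs). fint T f xs) (f, map (\<lambda>t. eval_tm T (\<lambda>i. xs ! i) t) ts))"
  proof (rule computable_on_comp)
    fix xs assume xs: "xs \<in> tuples T m"
    have "eval_tm T (\<lambda>i. xs ! i) t \<in> univ T" if "t \<in> set ts" for t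
    proof (rule eval_tm_in_univ[OF struct])
      show "wf_tm V t"
        using Fun.prems that by (simp add: list_all_iff)
      fix i assume "i \<in> tm_vars t"
      then have "i < m" using Fun.prems that by auto
      then show "xs ! i \<in> univ T"
        using xs nth_mem by (fastforce simp: tuples_def)
    qed
    then show "(f, map (\<lambda>t. eval_tm T (\<lambda>i. xs ! i) t) ts) \<in> (SIGMA f:funs V. tuples T (far V f))"
      using Fun.prems by (auto simp: tuples_def)
  qed
  then show ?case by simp
qed

text \<open>As for terms, the induction builds a program for one fixed formula. It ranges over both
  values of \<open>b\<close>, because negation switches between them.\<close>

lemma computable_on_cubes_inst:
  assumes "\<phi> \<in> qf_formulas (join_vocab V Q)" "free_vars \<phi> \<subseteq> {..<m}"
  shows "computable_on (tuples T m) (list_code ca) (list_code (list_code state_code))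
    (\<lambda>xs. cubes b (inst T (\<lambda>i. xs ! i) \<phi>))"
  using assms
proof (induction \<phi> arbitrary: b)
  case (Atom p)
  let ?D = "tuples T m"
  have wf: "wf_atom (join_vocab V Q) p" and fv: "atom_vars p \<subseteq> {..<m}"
    using Atom by (auto simp: qf_formulas_def free_vars_def)
  have eval_in: "eval_tm T (\<lambda>i. xs ! i) t \<in> univ T"
    if "wf_tm V t" "tm_vars t \<subseteq> {..<m}" "xs \<in> ?D" for t xs
    by (rule eval_tm_in_univ[OF struct that(1)])
      (use that nth_mem in \<open>fastforce simp: tuples_def\<close>)
  \<comment> \<open>Atoms of \<open>V\<close> turn into one of two constants, so their cubes are
    selected by a computable test.\<close>
  have truth: "computable_on ?D (list_code ca) (list_code (list_code state_code))
      (\<lambda>xs. cubes b (if P xs then Tru else Fls))"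
    if "computable_on ?D (list_code ca) of_bool P" for P
  proof -
    have "computable_on ?D (list_code ca) (list_code (list_code state_code))
      (\<lambda>xs. if P xs then cubes b Tru else cubes b Fls)"
      by (intro computable_on_if_total that computable_on_const)
    then show ?thesis
      by (rule computable_on_cong) simp
  qed
  show ?case
  proof (cases p)
    case (Eq s t)
    have "computable_on ?D (list_code ca) of_bool
        (\<lambda>xs. eval_tm T (\<lambda>i. xs ! i) s = eval_tm T (\<lambda>i. xs ! i) t)"
      by (rule computable_on_eq[OF computable_on_eval_tm computable_on_eval_tm inj_ca])
        (use wf fv in \<open>auto simp: Eq intro!: eval_in\<close>)
    then show ?thesis
      by (simp add: Eq truth)
  next
    case (Rel r ts)
    have ts: "wf_tm V t \<and> tm_vars t \<subseteq> {..<m}" if "t \<in> set ts" for t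
      using wf fv that by (auto simp: Rel)
    have args: "computable_on ?D (list_code ca) (list_code ca)
        (\<lambda>xs. map (\<lambda>t. eval_tm T (\<lambda>i. xs ! i) t) ts)"
      by (rule computable_on_map_fixed) (use ts in \<open>auto intro!: computable_on_eval_tm\<close>)
    show ?thesis
    proof (cases r)
      case (Inl r')
      have "computable_on (SIGMA r:rels V. tuples T (rar V r)) (app_code cr ca) of_bool
          (\<lambda>(r, xs). rint T r xs)"
        using presentation by (simp add: effective_presentation_def decidable_on_def)
      moreover have "computable_on ?D (list_code ca) (app_code cr ca)
          (\<lambda>xs. (r', map (\<lambda>t. eval_tm T (\<lambda>i. xs ! i) t) ts))"
        unfolding app_code_eq_pair_code
        by (intro computable_on_pair computable_on_const args)
      ultimately have "computable_on ?D (list_code ca) of_bool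
          (\<lambda>xs. (\<lambda>(r, xs). rint T r xs) (r', map (\<lambda>t. eval_tm T (\<lambda>i. xs ! i) t) ts))"
        by (rule computable_on_comp)
          (use wf ts in \<open>auto simp: Rel Inl join_vocab_def tuples_def[of T "rar V r'"] intro!: eval_in\<close>)
      then show ?thesis
        by (simp add: Rel Inl truth)
    next
      case (Inr q)
      have "computable_on ?D (list_code ca) (list_code (list_code state_code))
          (\<lambda>xs. [[(q, map (\<lambda>t. eval_tm T (\<lambda>i. xs ! i) t) ts)]])"
        unfolding app_code_eq_pair_code
        by (intro computable_on_Cons computable_on_pair computable_on_const args)
      then show ?thesis
        by (simp add: Rel Inr)
    qed
  qed
next
  case (Conj \<phi> \<psi>)
  have IH: "computable_on (tuples T m) (list_code ca) (list_code (list_code state_code))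
      (\<lambda>xs. cubes b (inst T (\<lambda>i. xs ! i) \<phi>))"
    "computable_on (tuples T m) (list_code ca) (list_code (list_code state_code))
      (\<lambda>xs. cubes b (inst T (\<lambda>i. xs ! i) \<psi>))" for b
    using Conj by (auto simp: qf_formulas_def free_vars_def)
  show ?case
  proof (cases b)
    case True
    then show ?thesis
      unfolding inst.simps cubes.simps
      by (simp only: if_True) (rule computable_on_map[where f="\<lambda>_. concat"] computable_on_concat
        computable_on_product_lists computable_on_Cons computable_on_const IH computable_on_snd_arg)+
  next
    case False
    then show ?thesis
      using computable_on_append[OF IH(1)[of b] IH(2)[of b]] by simp
  qed
next
  case (Disj \<phi> \<psi>)
  have IH: "computable_on (tuples T m) (list_code ca) (list_code (list_code state_code))
      (\<lambda>xs. cubes b (inst T (\<lambda>i. xs ! i) \<phi>))"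
    "computable_on (tuples T m) (list_code ca) (list_code (list_code state_code))
      (\<lambda>xs. cubes b (inst T (\<lambda>i. xs ! i) \<psi>))" for b
    using Disj by (auto simp: qf_formulas_def free_vars_def)
  show ?case
  proof (cases b)
    case False
    then show ?thesis
      unfolding inst.simps cubes.simps
      by (simp only: if_False) (rule computable_on_map[where f="\<lambda>_. concat"] computable_on_concat
        computable_on_product_lists computable_on_Cons computable_on_const IH computable_on_snd_arg)+
  next
    case True
    then show ?thesis
      using computable_on_append[OF IH(1)[of b] IH(2)[of b]] by simp
  qed
qed (auto simp: qf_formulas_def free_vars_def)

text \<open>Each pair of predicate symbol and alphabet letter has its own transition formula, hence
  its own program. The symbol is part of the input and selects the program; the alphabet letter
  stays a parameter.\<close>

lemma computable_on_cubes_delta_hat: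
  assumes \<sigma>: "\<sigma> \<in> alphabet A"
  shows "computable_on (states T Q \<times> univ T) (pair_code state_code ca)
    (list_code (list_code state_code)) (\<lambda>z. cubes True (delta_hat T A (fst z) \<sigma> (snd z)))"
proof (rule computable_on_case_finite[OF finite_Q _ codes_Q])
  show "computable_on (states T Q \<times> univ T) (pair_code state_code ca) cq (\<lambda>z. fst (fst z))"
    unfolding app_code_eq_pair_code by (rule computable_on_fst[OF computable_on_fst_arg])
  show "fst (fst z) \<in> rels Q" if "z \<in> states T Q \<times> univ T" for z
    using that by (auto simp: states_def)
  fix q assume q: "q \<in> rels Q"
  let ?D = "{z \<in> states T Q \<times> univ T. fst (fst z) = q}"
  have \<delta>: "delta A q \<sigma> \<in> qf_formulas (join_vocab V Q)" "free_vars (delta A q \<sigma>) \<subseteq> {..<Suc (rar Q q)}"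
    using automaton q \<sigma> unfolding lessThan_Suc_atMost
    by (auto simp: predicate_automaton_def pos_formulas_def)
  have "computable_on ?D (pair_code state_code ca) (list_code ca) (\<lambda>z. snd z # snd (fst z))"
    unfolding app_code_eq_pair_code
    by (intro computable_on_Cons computable_on_snd_arg computable_on_snd[OF computable_on_fst_arg])
  then have "computable_on ?D (pair_code state_code ca) (list_code (list_code state_code))
      (\<lambda>z. cubes True (inst T (\<lambda>i. (snd z # snd (fst z)) ! i) (delta A q \<sigma>)))"
    by (rule computable_on_comp[OF computable_on_cubes_inst[OF \<delta>]])
      (auto simp: states_def tuples_def)
  then show "computable_on ?D (pair_code state_code ca) (list_code (list_code state_code))
      (\<lambda>z. cubes True (delta_hat T A (fst z) \<sigma> (snd z)))"
    by (rule computable_on_cong) (auto simp: delta_hat_def)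
qed

lemma computable_on_cube_lists:
  assumes \<sigma>: "\<sigma> \<in> alphabet A"
  shows "computable_on {z. set (fst z) \<subseteq> states T Q \<and> snd z \<in> univ T}
    (pair_code (list_code state_code) ca) (list_code (list_code state_code))
    (\<lambda>z. cube_lists T A \<sigma> (fst z) (snd z))"
proof -
  let ?D = "{z :: ('q, 'a) state list \<times> 'a. set (fst z) \<subseteq> states T Q \<and> snd z \<in> univ T}"
  let ?c = "pair_code (list_code state_code) ca"
  have "computable_on (SIGMA z:?D. set (fst z)) (pair_code ?c state_code) (pair_code state_code ca)
      (\<lambda>y. (snd y, snd (fst y)))"
    by (intro computable_on_pair computable_on_snd_arg computable_on_snd[OF computable_on_fst_arg])
  then have "computable_on (SIGMA z:?D. set (fst z)) (pair_code ?c state_code)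
      (list_code (list_code state_code))
      (\<lambda>y. cubes True (delta_hat T A (fst (snd y, snd (fst y))) \<sigma> (snd (snd y, snd (fst y)))))"
    by (rule computable_on_comp[OF computable_on_cubes_delta_hat[OF \<sigma>]]) auto
  then have "computable_on (SIGMA z:?D. set (fst z)) (pair_code ?c state_code)
      (list_code (list_code state_code)) (\<lambda>y. cubes True (delta_hat T A (snd y) \<sigma> (snd (fst y))))"
    by simp
  then have "computable_on ?D ?c (list_code (list_code (list_code state_code)))
      (\<lambda>z. map (\<lambda>t. cubes True (delta_hat T A t \<sigma> (snd z))) (fst z))"
    by (rule computable_on_map[OF computable_on_fst_arg])
  then have "computable_on ?D ?c (list_code (list_code (list_code state_code)))
      (\<lambda>z. product_lists (map (\<lambda>t. cubes True (delta_hat T A t \<sigma> (snd z))) (fst z)))"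
    by (rule computable_on_product_lists)
  then show ?thesis
    unfolding cube_lists_def
    by (rule computable_on_map) (rule computable_on_concat[OF computable_on_snd_arg])
qed

section \<open>Oracle access: evaluation, type formulas and witnesses\<close>

lemma computable_on_sat:
  assumes "computable_on D c (list_code ca) f" "computable_on D c (qf_code cf cr) g"
    and "\<And>x. x \<in> D \<Longrightarrow> set (f x) \<subseteq> univ T \<and> g x \<in> qf_formulas V"
  shows "computable_on D c of_bool (\<lambda>x. sat T (f x) (g x))"
proof -
  have "computable_on D c (qf_code (const_code cf ca) cr) (\<lambda>x. pin (fst (f x, g x)) (snd (f x, g x)))"
    by (rule computable_on_comp_total[OF computable_on_pin computable_on_pair]) (rule assms)+
  from computable_on_comp[OF satisfiability_decidable[unfolded decidable_on_def] this]
  show ?thesis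
    using assms(3) by (simp add: sat_def pin_in_qf_formulas)
qed

text \<open>Adds length 0 to the given algorithm, so that empty argument lists require no separate
  treatment later.\<close>

lemma computable_classes:
  obtains \<Phi> where "computable_on UNIV id (list_code (qf_code cf cr)) \<Phi>"
    "\<And>d. defines_classes V T d (\<Phi> d)"
proof -
  obtain \<Phi> where \<Phi>: "computable_on {d. d \<ge> 1} id (\<lambda>\<phi>s. list_encode (map (qf_code cf cr) \<phi>s)) \<Phi>"
    "\<And>d. d \<ge> 1 \<Longrightarrow> defines_classes V T d (\<Phi> d)"
    using classes_computable by blast
  have "computable_on UNIV id (list_code (qf_code cf cr)) (\<lambda>d. if d = 0 then [Tru] else \<Phi> d)"
  proof (rule computable_on_if)
    show "computable_on UNIV id of_bool (\<lambda>d. d = 0)"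
      by (rule computable_on_eq_0[OF computable_on_id])
    have "computable_on {d. d \<ge> 1} id (list_code (qf_code cf cr)) \<Phi>"
      by (rule computable_on_recode[OF \<Phi>(1)]) (simp add: list_code_def)
    then show "computable_on {d \<in> UNIV. d \<noteq> 0} id (list_code (qf_code cf cr)) \<Phi>"
      by (rule computable_on_subset) auto
  qed (rule computable_on_const)
  moreover have "defines_classes V T d (if d = 0 then [Tru] else \<Phi> d)" for d
    using \<Phi>(2)[of d] defines_classes_0 by auto
  ultimately show thesis
    by (rule that)
qed

text \<open>The oracle asserts only that a letter exists. Trying the elements in the order of the
  enumeration, each time with all free variables pinned, finds one; the condition \<open>sat\<close>
  in the domain makes the search terminate.\<close>

lemma computable_witness:
  obtains w where "computable_on {z. set (fst z) \<subseteq> univ T \<and> snd z \<in> qf_formulas V \<and>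
      free_vars (snd z) \<subseteq> {..<Suc (length (fst z))} \<and> sat T (fst z) (snd z)}
      (pair_code (list_code ca) (qf_code cf cr)) ca (\<lambda>z. w (fst z) (snd z))"
    "\<And>as \<phi>. set as \<subseteq> univ T \<Longrightarrow> free_vars \<phi> \<subseteq> {..<Suc (length as)} \<Longrightarrow> sat T as \<phi> \<Longrightarrow>
      w as \<phi> \<in> univ T \<and> holds T (\<lambda>i. (as @ [w as \<phi>]) ! i) \<phi>"
proof -
  obtain e where e: "partrec (\<lambda>n. Some (e n))" "range e = ca ` univ T"
    using presentation by (auto simp: effective_presentation_def)
  \<comment> \<open>The enumeration lists codes. \<open>X n\<close> is the element with code
    \<open>e n\<close>, so the enumerating program itself computes \<open>X\<close>.\<close>
  define X where "X n = inv_into (univ T) ca (e n)" for n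
  have X_in: "X n \<in> univ T" and ca_X: "ca (X n) = e n" for n
  proof -
    have "e n \<in> ca ` univ T" using e(2) by auto
    then show "X n \<in> univ T" "ca (X n) = e n"
      unfolding X_def by (rule inv_into_into, rule f_inv_into_f)
  qed
  have X_surj: "\<exists>n. X n = x" if "x \<in> univ T" for x
    using that e(2) inj_ca by (metis X_def imageI inv_into_f_f rangeE)
  have X: "computable_on UNIV id ca X"
    by (rule computable_onI[OF e(1)]) (simp add: ca_X)
  define w where "w as \<phi> = X (LEAST n. sat T (as @ [X n]) \<phi>)" for as \<phi>
  have ex: "\<exists>n. sat T (as @ [X n]) \<phi>"
    if as: "set as \<subseteq> univ T" and \<phi>: "free_vars \<phi> \<subseteq> {..<Suc (length as)}" and sat: "sat T as \<phi>"
    for as \<phi>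
  proof -
    obtain x where x: "x \<in> univ T" "holds T (\<lambda>i. (as @ [x]) ! i) \<phi>"
      using sat unfolding sat_iff_ex_holds[OF as \<phi>] by blast
    obtain n where "X n = x"
      using X_surj[OF x(1)] by blast
    with x as \<phi> show ?thesis
      by (intro exI[of _ n]) (subst sat_iff_holds, auto)
  qed
  let ?D = "{z. set (fst z) \<subseteq> univ T \<and> snd z \<in> qf_formulas V \<and>
      free_vars (snd z) \<subseteq> {..<Suc (length (fst z))} \<and> sat T (fst z) (snd z)}"
  let ?c = "pair_code (list_code ca) (qf_code cf cr)"
  show thesis
  proof (rule that)
    have "computable_on (?D \<times> UNIV) (pair_code ?c id) of_bool
        (\<lambda>y. sat T (fst (fst y) @ [X (snd y)]) (snd (fst y)))"
      by (rule computable_on_sat)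
        ((rule computable_on_append computable_on_Cons computable_on_const
          computable_on_comp_total[OF X] computable_on_snd_arg
          computable_on_fst[OF computable_on_fst_arg] computable_on_snd[OF computable_on_fst_arg])+,
         use X_in in auto)
    then have "computable_on ?D ?c id (\<lambda>z. LEAST n. sat T (fst z @ [X n]) (snd z))"
      by (intro computable_on_Least) (use ex in \<open>auto simp: case_prod_unfold\<close>)
    then show "computable_on ?D ?c ca (\<lambda>z. w (fst z) (snd z))"
      unfolding w_def by (rule computable_on_comp_total[OF X])
    fix as and \<phi> :: "('f, 'r) qf"
    assume as: "set as \<subseteq> univ T" and \<phi>: "free_vars \<phi> \<subseteq> {..<Suc (length as)}" and "sat T as \<phi>"
    then have "sat T (as @ [w as \<phi>]) \<phi>"
      unfolding w_def by (rule LeastI_ex[OF ex])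
    moreover have "w as \<phi> \<in> univ T"
      by (simp add: w_def X_in)
    ultimately show "w as \<phi> \<in> univ T \<and> holds T (\<lambda>i. (as @ [w as \<phi>]) ! i) \<phi>"
      using as \<phi> by (subst (asm) sat_iff_holds) auto
  qed
qed

section \<open>Deciding the covering pre-order\<close>

lemma univ_nonempty: "univ T \<noteq> {}"
  using struct by (simp add: is_struct_def)

lemma defines_classes_formula:
  "defines_classes V T d \<phi>s \<Longrightarrow> \<phi> \<in> set \<phi>s \<Longrightarrow> \<phi> \<in> qf_formulas V \<and> free_vars \<phi> \<subseteq> {..<d}"
  by (simp add: defines_classes_def)

text \<open>Candidate images of the states of \<open>ts\<close> among those of \<open>us\<close>: an automorphism moving \<open>ts\<close> into
  \<open>us\<close> is determined, as far as covering is concerned, by the list of images of the states.\<close>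

definition matches :: "('q, 'a) state list \<Rightarrow> ('q, 'a) state list \<Rightarrow> ('q, 'a) state list list" where
  "matches ts us = product_lists (map (\<lambda>t. filter (\<lambda>u. fst u = fst t) us) ts)"

lemma in_matches_iff:
  "xs \<in> set (matches ts us) \<longleftrightarrow> list_all2 (\<lambda>x t. x \<in> set us \<and> fst x = fst t) xs ts"
  by (simp add: matches_def product_lists_set list_all2_map2)

lemma in_matches_subset:
  assumes "xs \<in> set (matches ts us)" shows "set xs \<subseteq> set us"
proof -
  have "\<forall>i<length xs. xs ! i \<in> set us"
    using assms by (simp add: in_matches_iff list_all2_conv_all_nth)
  then show ?thesis
    by (metis in_set_conv_nth subsetI)
qed

text \<open>An automorphism that covers \<open>ts\<close> by \<open>us\<close> sends
  \<open>ts\<close> to one of the finitely many candidate lists. For a given candidate, such an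
  automorphism exists iff the two flattened argument tuples have the same type, which the listed
  formulas detect.\<close>

lemma covering_le_iff_matches:
  assumes \<Phi>: "\<And>d. defines_classes V T d (\<Phi> d)"
    and ts: "set ts \<subseteq> states T Q" and us: "set us \<subseteq> states T Q"
  shows "covering_le V T (set ts) (set us) \<longleftrightarrow> (\<exists>xs\<in>set (matches ts us).
    \<exists>\<phi>\<in>set (\<Phi> (length (args ts))). sat T (args ts) \<phi> \<and> sat T (args xs) \<phi>)"
proof -
  let ?d = "length (args ts)"
  have len: "map (length \<circ> snd) xs = map (length \<circ> snd) ts" and sub: "set xs \<subseteq> states T Q"
    if xs: "xs \<in> set (matches ts us)" for xs
  proof -
    have xs': "list_all2 (\<lambda>x t. x \<in> set us \<and> fst x = fst t) xs ts"
      using xs by (simp add: in_matches_iff)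
    then have len_eq: "length xs = length ts" and nth: "\<And>i. i < length ts \<Longrightarrow> xs ! i \<in> set us \<and> fst (xs ! i) = fst (ts ! i)"
      by (simp_all add: list_all2_conv_all_nth)
    show "set xs \<subseteq> states T Q"
      using in_matches_subset[OF xs] us by blast
    have "length (snd (xs ! i)) = length (snd (ts ! i))" if i: "i < length ts" for i
    proof -
      have "xs ! i \<in> states T Q" "ts ! i \<in> states T Q"
        using nth[OF i] us ts nth_mem[OF i] by blast+
      then show ?thesis
        using nth[OF i] by (auto simp: states_def tuples_def)
    qed
    then show "map (length \<circ> snd) xs = map (length \<circ> snd) ts"
      using len_eq by (simp add: list_eq_iff_nth_eq)
  qed
  have len_args: "length (args xs) = ?d" if "xs \<in> set (matches ts us)" for xs
    using len[OF that] by (simp add: args_def length_concat)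
  have ts_tuple: "args ts \<in> tuples T ?d"
    using args_in_univ[OF ts] by (simp add: tuples_def)
  have xs_tuple: "args xs \<in> tuples T ?d" if "xs \<in> set (matches ts us)" for xs
    using args_in_univ[OF sub[OF that]] len_args[OF that] by (simp add: tuples_def)
  have "(\<exists>\<phi>\<in>set (\<Phi> ?d). sat T (args ts) \<phi> \<and> sat T (args xs) \<phi>) \<longleftrightarrow>
      (\<exists>\<pi>. automorphism V T \<pi> \<and> map \<pi> (args ts) = args xs)"
    if xs: "xs \<in> set (matches ts us)" for xs
  proof -
    have "sat T ys \<phi> \<longleftrightarrow> holds T (\<lambda>i. ys ! i) \<phi>"
      if "\<phi> \<in> set (\<Phi> ?d)" "ys \<in> tuples T ?d" for ys \<phi>
      by (rule sat_iff_holds[OF univ_nonempty])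
        (use that defines_classes_formula[OF \<Phi> that(1)] in \<open>auto simp: tuples_def\<close>)
    then have "(\<exists>\<phi>\<in>set (\<Phi> ?d). sat T (args ts) \<phi> \<and> sat T (args xs) \<phi>) \<longleftrightarrow>
        (args ts, args xs) \<in> simeq V T ?d"
      unfolding simeq_iff_common_formula[OF struct homogeneous \<Phi> ts_tuple xs_tuple[OF xs]]
      using ts_tuple xs_tuple[OF xs] by blast
    then show ?thesis
      using ts_tuple by (simp add: simeq_iff[OF struct homogeneous])
  qed
  then have "(\<exists>xs\<in>set (matches ts us).
      \<exists>\<phi>\<in>set (\<Phi> ?d). sat T (args ts) \<phi> \<and> sat T (args xs) \<phi>) \<longleftrightarrow>
    (\<exists>xs\<in>set (matches ts us). \<exists>\<pi>. automorphism V T \<pi> \<and> map \<pi> (args ts) = args xs)"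
    by blast
  also have "\<dots> \<longleftrightarrow> covering_le V T (set ts) (set us)"
    unfolding covering_le_iff
  proof
    assume "\<exists>xs\<in>set (matches ts us). \<exists>\<pi>. automorphism V T \<pi> \<and> map \<pi> (args ts) = args xs"
    then obtain xs \<pi> where xs: "xs \<in> set (matches ts us)" and \<pi>: "automorphism V T \<pi>"
      and eq: "map \<pi> (args ts) = args xs"
      by blast
    have xs': "list_all2 (\<lambda>x t. x \<in> set us \<and> fst x = fst t) xs ts"
      using xs by (simp add: in_matches_iff)
    \<comment> \<open>Equality of the flattened tuples splits into equality state by state: matched
      states have the same predicate symbol, hence argument lists of equal length.\<close>
    have "map (snd \<circ> map_state \<pi>) ts = map snd xs"
    proof (rule concat_injective)
      show "concat (map (snd \<circ> map_state \<pi>) ts) = concat (map snd xs)"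
        using eq unfolding args_map_state[symmetric] by (simp add: args_def)
      show "length (map (snd \<circ> map_state \<pi>) ts) = length (map snd xs)"
        using list_all2_lengthD[OF xs'] by simp
      show "\<forall>(x, y)\<in>set (zip (map (snd \<circ> map_state \<pi>) ts) (map snd xs)). length x = length y"
        using len[OF xs] list_all2_lengthD[OF xs']
        by (auto simp: set_zip list_eq_iff_nth_eq map_state_def)
    qed
    then have "map_state \<pi> (ts ! i) = xs ! i" if "i < length ts" for i
      using that xs' by (auto simp: list_eq_iff_nth_eq list_all2_conv_all_nth map_state_def prod_eq_iff)
    then have "map (map_state \<pi>) ts = xs"
      using list_all2_lengthD[OF xs'] by (simp add: list_eq_iff_nth_eq)
    then have "map_state \<pi> ` set ts \<subseteq> set us"
      using in_matches_subset[OF xs] by auto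
    with \<pi> show "\<exists>\<pi>. automorphism V T \<pi> \<and> map_state \<pi> ` set ts \<subseteq> set us"
      by blast
  next
    assume "\<exists>\<pi>. automorphism V T \<pi> \<and> map_state \<pi> ` set ts \<subseteq> set us"
    then obtain \<pi> where \<pi>: "automorphism V T \<pi>" "map_state \<pi> ` set ts \<subseteq> set us"
      by blast
    have "map (map_state \<pi>) ts \<in> set (matches ts us)"
      unfolding matches_def using \<pi>(2)
      by (intro map_in_product_lists) (auto simp: map_state_def)
    then show "\<exists>xs\<in>set (matches ts us). \<exists>\<pi>. automorphism V T \<pi> \<and> map \<pi> (args ts) = args xs"
      using \<pi>(1) args_map_state by metis
  qed
  finally show ?thesis by simp
qed

lemma decidable_covering_le:
  "decidable_on (configs T Q \<times> configs T Q)
     (\<lambda>(C, C'). prod_encode (config_code cq ca C, config_code cq ca C'))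
     (\<lambda>(C, C'). covering_le V T C C')"
proof -
  obtain \<Phi> where \<Phi>: "computable_on UNIV id (list_code (qf_code cf cr)) \<Phi>"
    and classes: "\<And>d. defines_classes V T d (\<Phi> d)"
    by (rule computable_classes) blast
  let ?D = "configs T Q \<times> configs T Q"
  let ?c = "pair_code (config_code cq ca) (config_code cq ca)"
  let ?ts = "\<lambda>z :: ('q, 'a) state set \<times> ('q, 'a) state set. conf_list (fst z)"
  let ?us = "\<lambda>z :: ('q, 'a) state set \<times> ('q, 'a) state set. conf_list (snd z)"
  have states: "set (?ts z) \<subseteq> states T Q" "set (?us z) \<subseteq> states T Q" if "z \<in> ?D" for z
    using that by (auto simp: set_conf_list, auto simp: configs_def)
  have ts: "computable_on ?D ?c (list_code state_code) ?ts"
    by (rule computable_on_conf_list[OF computable_on_fst_arg]) auto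
  have us: "computable_on ?D ?c (list_code state_code) ?us"
    by (rule computable_on_conf_list[OF computable_on_snd_arg]) auto
  \<comment> \<open>The domains \<open>?E\<close>, \<open>?F\<close> and \<open>?G\<close> pair the
    input with the values bound by the enclosing maps and bounded quantifiers. Membership in
    \<open>?G\<close> ensures that the oracle is asked only about well-formed formulas and tuples of
    the universe.\<close>
  let ?E = "SIGMA z:?D. set (?ts z)"
  have us': "computable_on ?E (pair_code ?c state_code) (list_code state_code) (\<lambda>y. ?us (fst y))"
    by (rule computable_on_comp[OF us computable_on_fst_arg]) auto
  have eq: "computable_on (SIGMA y:?E. set (?us (fst y))) (pair_code (pair_code ?c state_code) state_code)
      of_bool (\<lambda>x. fst (snd x) = fst (snd (fst x)))"
  proof (rule computable_on_eq[OF _ _ codes_Q])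
    show "computable_on (SIGMA y:?E. set (?us (fst y)))
        (pair_code (pair_code ?c state_code) state_code) cq (\<lambda>x. fst (snd x))"
      unfolding app_code_eq_pair_code by (rule computable_on_fst_snd_arg)
    show "computable_on (SIGMA y:?E. set (?us (fst y)))
        (pair_code (pair_code ?c state_code) state_code) cq (\<lambda>x. fst (snd (fst x)))"
      unfolding app_code_eq_pair_code
      by (rule computable_on_fst[OF computable_on_snd[OF computable_on_fst_arg]])
    fix x assume "x \<in> (SIGMA y:?E. set (?us (fst y)))"
    then have "fst (fst x) \<in> ?D" "snd x \<in> set (?us (fst (fst x)))"
      "snd (fst x) \<in> set (?ts (fst (fst x)))"
      by auto
    then have "snd x \<in> states T Q" "snd (fst x) \<in> states T Q"
      using states by (meson subsetD)+
    then show "fst (snd x) \<in> rels Q \<and> fst (snd (fst x)) \<in> rels Q"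
      by (auto simp: states_def)
  qed
  have "computable_on ?D ?c (list_code (list_code state_code))
      (\<lambda>z. map (\<lambda>t. filter (\<lambda>u. fst u = fst t) (?us z)) (?ts z))"
    by (rule computable_on_map[OF ts computable_on_filter[OF us' eq]])
  then have matches: "computable_on ?D ?c (list_code (list_code state_code))
      (\<lambda>z. matches (?ts z) (?us z))"
    unfolding matches_def by (rule computable_on_product_lists)
  let ?F = "SIGMA z:?D. set (matches (?ts z) (?us z))"
  let ?cF = "pair_code ?c (list_code state_code)"
  have ts': "computable_on ?F ?cF (list_code state_code) (\<lambda>y. ?ts (fst y))"
    by (rule computable_on_comp[OF ts computable_on_fst_arg]) auto
  have formulas: "computable_on ?F ?cF (list_code (qf_code cf cr))
      (\<lambda>y. \<Phi> (length (args (?ts (fst y)))))"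
    by (rule computable_on_comp_total[OF \<Phi>]) (rule computable_on_length computable_on_args ts')+
  let ?G = "SIGMA y:?F. set (\<Phi> (length (args (?ts (fst y)))))"
  let ?cG = "pair_code ?cF (qf_code cf cr)"
  have G: "set (args (?ts (fst (fst x)))) \<subseteq> univ T" "set (args (snd (fst x))) \<subseteq> univ T"
    "snd x \<in> qf_formulas V" if x: "x \<in> ?G" for x
  proof -
    have z: "fst (fst x) \<in> ?D" and m: "snd (fst x) \<in> set (matches (?ts (fst (fst x))) (?us (fst (fst x))))"
      using x by auto
    show "set (args (?ts (fst (fst x)))) \<subseteq> univ T"
      by (rule args_in_univ[OF states(1)[OF z]])
    have "set (snd (fst x)) \<subseteq> set (?us (fst (fst x)))"
      using m by (rule in_matches_subset)
    then show "set (args (snd (fst x))) \<subseteq> univ T"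
      using states(2)[OF z] by (intro args_in_univ) auto
    show "snd x \<in> qf_formulas V"
      using x defines_classes_formula[OF classes] by auto
  qed
  have ts'': "computable_on ?G ?cG (list_code state_code) (\<lambda>x. ?ts (fst (fst x)))"
    by (rule computable_on_comp[OF ts' computable_on_fst_arg]) auto
  have "computable_on ?G ?cG of_bool (\<lambda>x. sat T (args (?ts (fst (fst x)))) (snd x))"
    by (rule computable_on_sat[OF computable_on_args[OF ts''] computable_on_snd_arg]) (use G in auto)
  moreover have "computable_on ?G ?cG of_bool (\<lambda>x. sat T (args (snd (fst x))) (snd x))"
    by (rule computable_on_sat[OF computable_on_args[OF computable_on_snd[OF computable_on_fst_arg]]
      computable_on_snd_arg]) (use G in auto)
  ultimately have "computable_on ?G ?cG of_bool
      (\<lambda>x. sat T (args (?ts (fst (fst x)))) (snd x) \<and> sat T (args (snd (fst x))) (snd x))"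
    by (rule computable_on_and)
  from computable_on_ex[OF matches computable_on_ex[OF formulas this]]
  have "computable_on ?D ?c of_bool (\<lambda>z. \<exists>xs\<in>set (matches (?ts z) (?us z)).
      \<exists>\<phi>\<in>set (\<Phi> (length (args (?ts z)))). sat T (args (?ts z)) \<phi> \<and> sat T (args xs) \<phi>)"
    by simp
  then have "computable_on ?D ?c of_bool (\<lambda>(C, C'). covering_le V T C C')"
  proof (rule computable_on_cong)
    fix z assume z: "z \<in> ?D"
    then have "set (?ts z) = fst z" "set (?us z) = snd z"
      by (auto simp: set_conf_list)
    then show "(case z of (C, C') \<Rightarrow> covering_le V T C C') \<longleftrightarrow>
      (\<exists>xs\<in>set (matches (?ts z) (?us z)).
        \<exists>\<phi>\<in>set (\<Phi> (length (args (?ts z)))). sat T (args (?ts z)) \<phi> \<and> sat T (args xs) \<phi>)"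
      using covering_le_iff_matches[OF classes states[OF z]] by (simp add: case_prod_unfold)
  qed
  then show ?thesis
    by (simp add: decidable_on_def pair_code_def)
qed

section \<open>A finite basis of the successors\<close>

lemma computable_successors:
  "\<exists>S. computable_on (configs T Q) (config_code cq ca)
         (\<lambda>\<C>. set_encode (config_code cq ca ` \<C>)) S \<and>
       (\<forall>C\<in>configs T Q.
          finite (S C) \<and> (\<forall>C'\<in>S C. successor T A C C') \<and>
          (\<forall>C'. successor T A C C' \<longrightarrow> (\<exists>D\<in>S C. covering_le V T D C')))"
proof -
  obtain \<Phi> where \<Phi>: "computable_on UNIV id (list_code (qf_code cf cr)) \<Phi>"
    and classes: "\<And>d. defines_classes V T d (\<Phi> d)"
    by (rule computable_classes) blast
  obtain w where w: "computable_on {z. set (fst z) \<subseteq> univ T \<and> snd z \<in> qf_formulas V \<and>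
      free_vars (snd z) \<subseteq> {..<Suc (length (fst z))} \<and> sat T (fst z) (snd z)}
      (pair_code (list_code ca) (qf_code cf cr)) ca (\<lambda>z. w (fst z) (snd z))"
    and w_holds: "\<And>as \<phi>. set as \<subseteq> univ T \<Longrightarrow> free_vars \<phi> \<subseteq> {..<Suc (length as)} \<Longrightarrow> sat T as \<phi> \<Longrightarrow>
      w as \<phi> \<in> univ T \<and> holds T (\<lambda>i. (as @ [w as \<phi>]) ! i) \<phi>"
    by (rule computable_witness) blast
  let ?D = "configs T Q"
  let ?c = "config_code cq ca"
  let ?a = "\<lambda>C. args (conf_list C)"
  have sub: "set (conf_list C) \<subseteq> states T Q" if "C \<in> ?D" for C
    using that by (simp add: set_conf_list) (simp add: configs_def)
  have a_univ: "set (?a C) \<subseteq> univ T" if "C \<in> ?D" for C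
    by (rule args_in_univ[OF sub[OF that]])
  \<comment> \<open>Variable \<open>length (?a C)\<close> is the letter: the formulas kept are those
    of the types that the arguments form with some letter.\<close>
  define types where "types C = filter (\<lambda>\<phi>. sat T (?a C) \<phi>) (\<Phi> (Suc (length (?a C))))" for C
  have formula: "\<phi> \<in> qf_formulas V" "free_vars \<phi> \<subseteq> {..<Suc (length (?a C))}"
    if "\<phi> \<in> set (\<Phi> (Suc (length (?a C))))" for C \<phi>
    using defines_classes_formula[OF classes that] by auto
  have list: "computable_on ?D ?c (list_code state_code) (\<lambda>C. conf_list C)"
    by (rule computable_on_conf_list[OF computable_on_id])
  have a: "computable_on ?D ?c (list_code ca) ?a"
    by (rule computable_on_args[OF list])
  have a': "computable_on (SIGMA C:?D. X C) (pair_code ?c d) (list_code ca) (\<lambda>y. ?a (fst y))"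
    for X :: "('q, 'a) state set \<Rightarrow> 'x set" and d
    by (rule computable_on_comp[OF a computable_on_fst_arg]) auto
  have "computable_on ?D ?c (list_code (qf_code cf cr)) (\<lambda>C. \<Phi> (Suc (length (?a C))))"
    by (rule computable_on_comp_total[OF \<Phi>]) (rule computable_on_Suc computable_on_length a)+
  moreover have "computable_on (SIGMA C:?D. set (\<Phi> (Suc (length (?a C)))))
      (pair_code ?c (qf_code cf cr)) of_bool (\<lambda>y. sat T (?a (fst y)) (snd y))"
  proof (rule computable_on_sat[OF a' computable_on_snd_arg])
    fix y assume "y \<in> (SIGMA C:?D. set (\<Phi> (Suc (length (?a C)))))"
    then have "fst y \<in> ?D" "snd y \<in> set (\<Phi> (Suc (length (?a (fst y)))))"
      by auto
    then show "set (?a (fst y)) \<subseteq> univ T \<and> snd y \<in> qf_formulas V"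
      using a_univ formula(1) by simp
  qed
  ultimately have types: "computable_on ?D ?c (list_code (qf_code cf cr)) types"
    unfolding types_def by (rule computable_on_filter)
  \<comment> \<open>All cubes under one witness letter for each realised type, for a fixed
    \<open>\<sigma>\<close>.\<close>
  define R where "R \<sigma> C = concat (map (\<lambda>\<phi>. cube_lists T A \<sigma> (conf_list C) (w (?a C) \<phi>)) (types C))"
    for \<sigma> C
  have types_w: "w (?a C) \<phi> \<in> univ T" "holds T (\<lambda>i. (?a C @ [w (?a C) \<phi>]) ! i) \<phi>"
    if "C \<in> ?D" "\<phi> \<in> set (types C)" for C \<phi>
    using w_holds[OF a_univ[OF that(1)], of \<phi>] formula that(2) by (auto simp: types_def)
  have R: "computable_on ?D ?c (list_code (list_code state_code)) (R \<sigma>)" if \<sigma>: "\<sigma> \<in> alphabet A" for \<sigma>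
  proof -
    let ?E = "SIGMA C:?D. set (types C)"
    let ?cE = "pair_code ?c (qf_code cf cr)"
    have "computable_on ?E ?cE ca
        (\<lambda>y. w (fst (?a (fst y), snd y)) (snd (?a (fst y), snd y)))"
    proof (rule computable_on_comp[OF w computable_on_pair[OF a' computable_on_snd_arg]])
      fix y assume "y \<in> ?E"
      then have y: "fst y \<in> ?D" "snd y \<in> set (\<Phi> (Suc (length (?a (fst y)))))"
        "sat T (?a (fst y)) (snd y)"
        by (auto simp: types_def)
      show "(?a (fst y), snd y) \<in> {z. set (fst z) \<subseteq> univ T \<and> snd z \<in> qf_formulas V \<and>
          free_vars (snd z) \<subseteq> {..<Suc (length (fst z))} \<and> sat T (fst z) (snd z)}"
        using a_univ[OF y(1)] formula[OF y(2)] y(3) by simp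
    qed
    then have "computable_on ?E ?cE ca (\<lambda>y. w (?a (fst y)) (snd y))"
      by simp
    moreover have "computable_on ?E ?cE (list_code state_code) (\<lambda>y. conf_list (fst y))"
      by (rule computable_on_comp[OF list computable_on_fst_arg]) auto
    ultimately have "computable_on ?E ?cE (pair_code (list_code state_code) ca)
        (\<lambda>y. (conf_list (fst y), w (?a (fst y)) (snd y)))"
      by (intro computable_on_pair)
    then have "computable_on ?E ?cE (list_code (list_code state_code))
        (\<lambda>y. cube_lists T A \<sigma> (fst (conf_list (fst y), w (?a (fst y)) (snd y)))
          (snd (conf_list (fst y), w (?a (fst y)) (snd y))))"
    proof (rule computable_on_comp[OF computable_on_cube_lists[OF \<sigma>]])
      fix y assume "y \<in> ?E"
      then have "fst y \<in> ?D" "snd y \<in> set (types (fst y))"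
        by auto
      then show "(conf_list (fst y), w (?a (fst y)) (snd y)) \<in>
          {z. set (fst z) \<subseteq> states T Q \<and> snd z \<in> univ T}"
        using sub types_w(1) by simp
    qed
    then have "computable_on ?E ?cE (list_code (list_code state_code))
        (\<lambda>y. cube_lists T A \<sigma> (conf_list (fst y)) (w (?a (fst y)) (snd y)))"
      by simp
    then show ?thesis
      unfolding R_def by (rule computable_on_concat[OF computable_on_map[OF types]])
  qed
  \<comment> \<open>Symbols of the alphabet have no codes; the finite alphabet is a list built into
    the program.\<close>
  obtain \<sigma>s where \<sigma>s: "set \<sigma>s = alphabet A"
    using automaton finite_list[of "alphabet A"] by (auto simp: predicate_automaton_def)
  define L where "L C = concat (map (\<lambda>\<sigma>. R \<sigma> C) \<sigma>s)" for C
  have "computable_on ?D ?c (list_code (list_code state_code)) L"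
    unfolding L_def by (rule computable_on_concat[OF computable_on_map_fixed]) (simp add: \<sigma>s R)
  moreover have "computable_on (SIGMA C:?D. set (L C)) (pair_code ?c (list_code state_code)) id
      (\<lambda>y. set_encode (set (map state_code (snd y))))"
  proof (rule computable_on_code[OF computable_on_set])
    show "computable_on (SIGMA C:?D. set (L C)) (pair_code ?c (list_code state_code)) (list_code id)
        (\<lambda>y. map state_code (snd y))"
      by (rule computable_on_recode[OF computable_on_snd_arg]) (simp add: list_code_def)
  qed
  ultimately have "computable_on ?D ?c (list_code id)
      (\<lambda>C. map (\<lambda>c. set_encode (set (map state_code c))) (L C))"
    by (rule computable_on_map)
  then have "computable_on ?D ?c set_encode
      (\<lambda>C. set (map (\<lambda>c. set_encode (set (map state_code c))) (L C)))"
    by (rule computable_on_set)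
  then have "computable_on ?D ?c (\<lambda>\<C>. set_encode (config_code cq ca ` \<C>)) (\<lambda>C. set ` set (L C))"
    by (rule computable_on_recode) (simp add: image_image config_code_def)
  moreover have "successor T A C C'" if C: "C \<in> ?D" and C': "C' \<in> set ` set (L C)" for C C'
  proof -
    obtain \<sigma> \<phi> where \<sigma>: "\<sigma> \<in> alphabet A" and \<phi>: "\<phi> \<in> set (types C)"
      and "C' \<in> set ` set (cube_lists T A \<sigma> (conf_list C) (w (?a C) \<phi>))"
      using C' by (auto simp: L_def R_def \<sigma>s)
    then have "step T A C \<sigma> (w (?a C) \<phi>) C'"
      unfolding step_iff_cube_lists[OF automaton C \<sigma> distinct_conf_list[OF C] set_conf_list[OF C]]
      by blast
    then show ?thesis
      using \<sigma> types_w(1)[OF C \<phi>] by (auto simp: successor_def)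
  qed
  moreover have "\<exists>D\<in>set ` set (L C). covering_le V T D C'"
    if C: "C \<in> ?D" and C': "successor T A C C'" for C C'
  proof -
    obtain \<sigma> b where \<sigma>: "\<sigma> \<in> alphabet A" and b: "b \<in> univ T" and step: "step T A C \<sigma> b C'"
      using C' by (auto simp: successor_def)
    let ?d = "Suc (length (?a C))"
    have tuple: "?a C @ [x] \<in> tuples T ?d" if "x \<in> univ T" for x
      using that a_univ[OF C] by (simp add: tuples_def)
    \<comment> \<open>Reflexivity yields a listed formula that holds at the tuple ending in
      \<open>b\<close>, that is, the type of \<open>b\<close> over the arguments.\<close>
    have "(?a C @ [b], ?a C @ [b]) \<in> simeq V T ?d"
      unfolding simeq_iff[OF struct homogeneous] using tuple[OF b] automorphism_id[of V T] by auto
    then obtain \<phi> where \<phi>: "\<phi> \<in> set (\<Phi> ?d)" "holds T (\<lambda>i. (?a C @ [b]) ! i) \<phi>"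
      unfolding simeq_iff_common_formula[OF struct homogeneous classes tuple[OF b] tuple[OF b]]
      by blast
    have \<phi>_types: "\<phi> \<in> set (types C)"
      using \<phi> b sat_iff_ex_holds[OF a_univ[OF C] formula(2)[OF \<phi>(1)]] by (auto simp: types_def)
    let ?x = "w (?a C) \<phi>"
    note x = types_w[OF C \<phi>_types]
    \<comment> \<open>The witness \<open>?x\<close> satisfies the same formula, so some automorphism
      fixes all arguments and moves \<open>?x\<close> to \<open>b\<close>.\<close>
    have "(?a C @ [?x], ?a C @ [b]) \<in> simeq V T ?d"
      unfolding simeq_iff_common_formula[OF struct homogeneous classes tuple[OF x(1)] tuple[OF b]]
      using \<phi> x(2) by blast
    then obtain \<pi> where \<pi>: "automorphism V T \<pi>" and "map \<pi> (?a C @ [?x]) = ?a C @ [b]"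
      unfolding simeq_iff[OF struct homogeneous] by blast
    then have fixed: "map \<pi> (?a C) = ?a C" and "\<pi> ?x = b"
      by simp_all
    have "map_state \<pi> t = t" if "t \<in> C" for t
    proof -
      have "set (snd t) \<subseteq> set (?a C)"
        using that by (auto simp: args_def set_conf_list[OF C])
      moreover have "\<pi> y = y" if "y \<in> set (?a C)" for y
        using fixed that map_eq_conv[of \<pi> "?a C" id] by simp
      ultimately have "map \<pi> (snd t) = snd t"
        by (intro map_idI) auto
      then show ?thesis
        by (simp add: map_state_def)
    qed
    \<comment> \<open>All states of \<open>C\<close> are fixed, so the simulation applies to
      \<open>C\<close> against itself, with \<open>?x\<close> read in place of
      \<open>b\<close>.\<close>
    then have "map_state \<pi> ` C \<subseteq> C"
      by auto
    moreover have "step T A C \<sigma> (\<pi> ?x) C'"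
      using step by (simp add: \<open>\<pi> ?x = b\<close>)
    ultimately obtain D where D: "step T A C \<sigma> ?x D" "map_state \<pi> ` D \<subseteq> C'"
      by (rule step_automorphism_subset[OF struct \<pi> automaton C C _ \<sigma> x(1)])
    have "D \<in> set ` set (cube_lists T A \<sigma> (conf_list C) ?x)"
      using D(1)
      unfolding step_iff_cube_lists[OF automaton C \<sigma> distinct_conf_list[OF C] set_conf_list[OF C]] .
    then have "D \<in> set ` set (L C)"
      using \<phi>_types \<sigma> by (auto simp: L_def R_def \<sigma>s)
    moreover have "covering_le V T D C'"
      unfolding covering_le_iff using \<pi> D(2) by blast
    ultimately show ?thesis by blast
  qed
  ultimately show ?thesis
    by (intro exI[of _ "\<lambda>C. set ` set (L C)"]) auto
qed

section \<open>Compatibility of covering with acceptance and transitions\<close>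

lemma covering_le_accepting:
  "covering_le V T D C \<Longrightarrow> accepting A C \<Longrightarrow> accepting A D"
  by (force simp: covering_le_def accepting_def)

lemma covering_le_successor:
  assumes D: "D \<in> configs T Q" and C: "C \<in> configs T Q" and le: "covering_le V T D C"
    and C': "successor T A C C'"
  shows "\<exists>D'. successor T A D D'"
proof -
  obtain \<pi> where \<pi>: "automorphism V T \<pi>" and DC: "map_state \<pi> ` D \<subseteq> C"
    using le by (auto simp: covering_le_iff)
  obtain \<sigma> b where \<sigma>: "\<sigma> \<in> alphabet A" and b: "b \<in> univ T" and step: "step T A C \<sigma> b C'"
    using C' by (auto simp: successor_def)
  \<comment> \<open>The smaller configuration reads the preimage of the letter, which exists by
    surjectivity of \<open>\<pi>\<close>.\<close>
  obtain a where a: "a \<in> univ T" "b = \<pi> a"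
    using b automorphism_bij[OF \<pi>] by (auto simp: bij_betw_def)
  obtain D' where "step T A D \<sigma> a D'"
    using step unfolding a(2)
    by (rule step_automorphism_subset[OF struct \<pi> automaton C D DC \<sigma> a(1)])
  then show ?thesis
    using \<sigma> a(1) by (auto simp: successor_def)
qed

end

theorem theorem7p13:
  fixes V :: "('f, 'r) vocab" and T :: "('f, 'r, 'a) struct"
    and cf :: "'f \<Rightarrow> nat" and cr :: "'r \<Rightarrow> nat" and ca :: "'a \<Rightarrow> nat"
    and Q :: "('f, 'q) vocab" and cq :: "'q \<Rightarrow> nat"
    and A :: "('f, 'r, 'q, 's) pautomaton"
  assumes struct: "is_struct V T"
    and presentation: "effective_presentation V T cf cr ca"
    and homogeneous: "homogeneous V T"
    and finite_classes: "\<And>d. d \<ge> 1 \<Longrightarrow> finite (tuples T d // simeq V T d)"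
    and classes_computable:
      "\<exists>\<Phi>. computable_on {d. d \<ge> 1} id (\<lambda>\<phi>s. list_encode (map (qf_code cf cr) \<phi>s)) \<Phi> \<and>
           (\<forall>d\<ge>1. defines_classes V T d (\<Phi> d))"
    and satisfiability_decidable:
      "decidable_on (qf_formulas (const_vocab V T)) (qf_code (const_code cf ca) cr)
         (satisfiable (const_struct T))"
    and relational: "funs Q = {}"
    and finite_Q: "finite (rels Q)"
    and codes_Q: "inj_on cq (rels Q)"
    and automaton: "predicate_automaton V Q A"
  shows "decidable_on (configs T Q \<times> configs T Q)
           (\<lambda>(C, C'). prod_encode (config_code cq ca C, config_code cq ca C'))
           (\<lambda>(C, C'). covering_le V T C C')
    \<and> (\<exists>S. computable_on (configs T Q) (config_code cq ca)
             (\<lambda>\<C>. set_encode (config_code cq ca ` \<C>)) S \<and>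
           (\<forall>C\<in>configs T Q.
              finite (S C) \<and> (\<forall>C'\<in>S C. successor T A C C') \<and>
              (\<forall>C'. successor T A C C' \<longrightarrow> (\<exists>D\<in>S C. covering_le V T D C'))))
    \<and> (\<forall>D\<in>configs T Q. \<forall>C\<in>configs T Q. covering_le V T D C \<longrightarrow>
         (accepting A C \<longrightarrow> accepting A D) \<and>
         (\<forall>C'. successor T A C C' \<longrightarrow> (\<exists>D'. successor T A D D')))"
proof -
  interpret effective_automaton V T cf cr ca Q cq A
    by unfold_locales (fact assms)+
  show ?thesis
    using decidable_covering_le computable_successors covering_le_accepting covering_le_successor
    by blast
qed

end
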